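(* Let $n,k$ be integers with $1\le k\le n-2$ and let $G\in\mathcal{G}^*_{n,k}$. Then: (i) For $\alpha=0$, $\mu_\alpha(G)\ge \mu_\alpha(K(n,k,1))=\mu_\alpha(K(n,k,n-k-1))$, with equality if and only if $G\cong K(n,k,n-k-1)$ or $G\cong K(n,k,1)$. (ii) For $0<\alpha<1$, $\mu_\alpha(G)\ge\mu_\alpha(K(n,k,1))$, with equality if and only if $G\cong K(n,k,1)$.
   Context: Digraphs are finite and simple (no loops, no multiple arcs; two opposite arcs $(u,v),(v,u)$ are allowed). A digraph is strongly connected if for every ordered pair of vertices there is a directed path from the first to the second. For a strongly connected digraph $G$ with vertices $v_1,\dots,v_n$, $D(G)=(d_{ij})$ is the distance matrix, where $d_{ij}$ is the length of a shortest directed path from $v_i$ to $v_j$; $D_i=\sum_{j=1}^n d_{ij}$ is the transmission of $v_i$; $Diag(Tr)=\mathrm{diag}(D_1,\dots,D_n)$; and $D_\alpha(G)=\alpha\, Diag(Tr)+(1-\alpha)D(G)$. The $D_\alpha$ spectral radius $\mu_\alpha(G)$ is the spectral radius of $D_\alpha(G)$, i.e. its eigenvalue of largest modulus. The arc connectivity $\kappa'(G)$ of a strongly connected digraph $G$ is the minimum number of arcs whose deletion yields a digraph that is not strongly connected. $\mathcal{G}^*_{n,k}$ is the set of strongly connected digraphs of order $n$ with $\kappa'(G)=k$. For $1\le m\le n-k-1$, $K(n,k,m)$ is the digraph $\overset{\longleftrightarrow}{K_k}\vee(\overset{\longleftrightarrow}{K_{n-k-m}}\cup\overset{\longleftrightarrow}{K_m})+E$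 with $E=\{(u,v):u\in V(\overset{\longleftrightarrow}{K_m}),\,v\in V(\overset{\longleftrightarrow}{K_{n-k-m}})\}$. Here $\overset{\longleftrightarrow}{K_r}$ is the complete digraph on $r$ vertices (both arcs between every two distinct vertices), $\cup$ is disjoint union, $G_1\vee G_2$ is the join (disjoint union together with all arcs in both directions between $G_1$ and $G_2$), and $+E$ means adding the arcs of $E$. *)

theory Defs
  imports
    "Graph_Theory.Digraph_Isomorphism"
    "Graph_Theory.Kuratowski"
    "Jordan_Normal_Form.Spectral_Radius"
begin

section \<open>Distance matrices of digraphs\<close>

text \<open>
  The locale \<open>digraph\<close> of the library describes finite digraphs without loops and multiple arcs.
  The value of the distance below is only meaningful if \<open>v\<close> is reachable from \<open>u\<close>.
\<close>

definition digraph_dist :: "('a,'b) pre_digraph \<Rightarrow> 'a \<Rightarrow> 'a \<Rightarrow> nat" where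
  "digraph_dist G u v = (LEAST l. \<exists>p. pre_digraph.apath G u p v \<and> length p = l)"

definition transmission :: "('a,'b) pre_digraph \<Rightarrow> 'a \<Rightarrow> nat" where
  "transmission G u = (\<Sum>v\<in>verts G. digraph_dist G u v)"

definition enumerates_verts :: "('a,'b) pre_digraph \<Rightarrow> 'a list \<Rightarrow> bool" where
  "enumerates_verts G vs \<longleftrightarrow> distinct vs \<and> set vs = verts G"

definition distance_mat :: "('a,'b) pre_digraph \<Rightarrow> 'a list \<Rightarrow> real mat" where
  "distance_mat G vs =
     mat (length vs) (length vs) (\<lambda>(i,j). real (digraph_dist G (vs ! i) (vs ! j)))"

definition transmission_mat :: "('a,'b) pre_digraph \<Rightarrow> 'a list \<Rightarrow> real mat" where
  "transmission_mat G vs = mat_diag (length vs) (\<lambda>i. real (transmission G (vs ! i)))"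

definition D_alpha_mat :: "real \<Rightarrow> ('a,'b) pre_digraph \<Rightarrow> 'a list \<Rightarrow> real mat" where
  "D_alpha_mat \<alpha> G vs = \<alpha> \<cdot>\<^sub>m transmission_mat G vs + (1 - \<alpha>) \<cdot>\<^sub>m distance_mat G vs"

text \<open>
  The matrices depend on an enumeration of the vertices, the spectral radius does not; see
  \<open>D_alpha_spectral_radius_eq\<close> below.
\<close>

definition D_alpha_spectral_radius :: "real \<Rightarrow> ('a,'b) pre_digraph \<Rightarrow> real" where
  "D_alpha_spectral_radius \<alpha> G =
     spectral_radius (map_mat complex_of_real (D_alpha_mat \<alpha> G (SOME vs. enumerates_verts G vs)))"

lemma D_alpha_mat_carrier [simp]:
  "D_alpha_mat \<alpha> G vs \<in> carrier_mat (length vs) (length vs)"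
  by (auto simp: D_alpha_mat_def transmission_mat_def distance_mat_def mat_diag_def)

lemma D_alpha_mat_index:
  assumes "distinct vs" "i < length vs" "j < length vs"
  shows "D_alpha_mat \<alpha> G vs $$ (i,j) =
    (if vs ! i = vs ! j then \<alpha> * real (transmission G (vs ! i)) else 0)
      + (1 - \<alpha>) * real (digraph_dist G (vs ! i) (vs ! j))"
  using assms
  by (auto simp: D_alpha_mat_def transmission_mat_def distance_mat_def mat_diag_def
      nth_eq_iff_index_eq)

lemma eigenvalue_D_alpha_mat_mono:
  fixes G :: "('a,'b) pre_digraph"
  assumes vs: "enumerates_verts G vs" and ws: "enumerates_verts G ws"
    and ev: "eigenvalue (map_mat complex_of_real (D_alpha_mat \<alpha> G vs)) c"
  shows "eigenvalue (map_mat complex_of_real (D_alpha_mat \<alpha> G ws)) c"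
proof -
  define n where "n = length vs"
  have d: "distinct vs" "distinct ws" and s: "set vs = set ws"
    using vs ws by (auto simp: enumerates_verts_def)
  have lw: "length ws = n"
    unfolding n_def by (metis d s distinct_card)
  have dimv: "dim_row (D_alpha_mat \<alpha> G vs) = n" "dim_col (D_alpha_mat \<alpha> G vs) = n"
    using D_alpha_mat_carrier[of \<alpha> G vs] by (auto simp: n_def simp del: D_alpha_mat_carrier)
  have dimw: "dim_row (D_alpha_mat \<alpha> G ws) = n" "dim_col (D_alpha_mat \<alpha> G ws) = n"
    using D_alpha_mat_carrier[of \<alpha> G ws] lw by (auto simp del: D_alpha_mat_carrier)
  have bv: "bij_betw ((!) vs) {..<n} (set vs)" and bw: "bij_betw ((!) ws) {..<n} (set vs)"
    using bij_betw_nth[OF d(1)] bij_betw_nth[OF d(2)] lw s by (auto simp: n_def)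
  define f where "f = (\<lambda>i. the_inv_into {..<n} ((!) vs) (ws ! i))"
  have bf: "bij_betw f {..<n} {..<n}"
    using bij_betw_trans[OF bw bij_betw_the_inv_into[OF bv]] by (simp add: f_def comp_def)
  have f: "f i < n" "vs ! f i = ws ! i" if "i < n" for i
    using bf that f_the_inv_into_f_bij_betw[OF bv, of "ws ! i"] bw
    by (auto simp: f_def bij_betw_def)
  have ent: "D_alpha_mat \<alpha> G ws $$ (i,j) = D_alpha_mat \<alpha> G vs $$ (f i, f j)"
    if "i < n" "j < n" for i j
    using that f[OF that(1)] f[OF that(2)] lw d by (simp add: D_alpha_mat_index n_def)
  obtain x where x: "x \<in> carrier_vec n" "x \<noteq> 0\<^sub>v n"
    and eq: "map_mat complex_of_real (D_alpha_mat \<alpha> G vs) *\<^sub>v x = c \<cdot>\<^sub>v x"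
    using ev by (auto simp: eigenvalue_def eigenvector_def dimv)
  define y where "y = vec n (\<lambda>i. x $ f i)"
  have eqi: "(\<Sum>j<n. complex_of_real (D_alpha_mat \<alpha> G vs $$ (i,j)) * x $ j) = c * x $ i"
    if "i < n" for i
    using arg_cong[OF eq, of "\<lambda>v. v $ i"] that x(1)
    by (simp add: scalar_prod_def dimv atLeast0LessThan)
  have "map_mat complex_of_real (D_alpha_mat \<alpha> G ws) *\<^sub>v y = c \<cdot>\<^sub>v y"
  proof (rule eq_vecI)
    fix i assume "i < dim_vec (c \<cdot>\<^sub>v y)"
    hence i: "i < n" by (simp add: y_def)
    have "(map_mat complex_of_real (D_alpha_mat \<alpha> G ws) *\<^sub>v y) $ i =
        (\<Sum>j<n. complex_of_real (D_alpha_mat \<alpha> G vs $$ (f i, f j)) * x $ f j)"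
      using i by (simp add: scalar_prod_def dimw atLeast0LessThan y_def ent)
    also have "\<dots> = (\<Sum>j<n. complex_of_real (D_alpha_mat \<alpha> G vs $$ (f i, j)) * x $ j)"
      by (rule sum.reindex_bij_betw[OF bf])
    also have "\<dots> = c * x $ f i" by (rule eqi[OF f(1)[OF i]])
    finally show "(map_mat complex_of_real (D_alpha_mat \<alpha> G ws) *\<^sub>v y) $ i = (c \<cdot>\<^sub>v y) $ i"
      using i by (simp add: y_def)
  qed (simp add: dimw y_def)
  moreover have "y \<noteq> 0\<^sub>v n"
  proof
    assume y0: "y = 0\<^sub>v n"
    have "x $ k = 0" if "k < n" for k
    proof -
      have "k \<in> f ` {..<n}" using bf that by (simp add: bij_betw_def)
      then obtain i where "i < n" "f i = k" by auto
      thus ?thesis using arg_cong[OF y0, of "\<lambda>v. v $ i"] by (simp add: y_def)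
    qed
    hence "x = 0\<^sub>v n" using x(1) by (intro eq_vecI) auto
    thus False using x(2) by simp
  qed
  ultimately show ?thesis
    by (auto simp: eigenvalue_def eigenvector_def dimw y_def intro!: exI[of _ y])
qed

lemma D_alpha_spectral_radius_eq:
  assumes "enumerates_verts G vs"
  shows "D_alpha_spectral_radius \<alpha> G =
    spectral_radius (map_mat complex_of_real (D_alpha_mat \<alpha> G vs))"
proof -
  have "enumerates_verts G (SOME vs. enumerates_verts G vs)"
    using assms by (rule someI)
  hence "spectrum (map_mat complex_of_real (D_alpha_mat \<alpha> G (SOME vs. enumerates_verts G vs)))
       = spectrum (map_mat complex_of_real (D_alpha_mat \<alpha> G vs))"
    unfolding spectrum_def using assms eigenvalue_D_alpha_mat_mono by blast
  thus ?thesis by (simp add: D_alpha_spectral_radius_def spectral_radius_def)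
qed

section \<open>Arc connectivity\<close>

definition arc_connectivity :: "('a,'b) pre_digraph \<Rightarrow> nat" where
  "arc_connectivity G =
     (LEAST k. \<exists>S \<subseteq> arcs G. card S = k \<and> \<not> strongly_connected (G\<lparr>arcs := arcs G - S\<rparr>))"

definition digraphs_arc_connectivity :: "nat \<Rightarrow> nat \<Rightarrow> ('a,'b) pre_digraph set" where
  "digraphs_arc_connectivity n k =
     {G. digraph G \<and> strongly_connected G \<and> card (verts G) = n \<and> arc_connectivity G = k}"

section \<open>The digraphs \<open>K(n,k,m)\<close>\<close>

definition complete_digraph_on :: "'a set \<Rightarrow> ('a, 'a \<times> 'a) pre_digraph" where
  "complete_digraph_on A =
     \<lparr>verts = A, arcs = {(u,v). u \<in> A \<and> v \<in> A \<and> u \<noteq> v}, tail = fst, head = snd\<rparr>"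

lemma complete_digraph_complete_digraph_on:
  assumes "finite A"
  shows "complete_digraph (card A) (complete_digraph_on A)"
proof -
  have "finite {(u,v). u \<in> A \<and> v \<in> A \<and> u \<noteq> v}"
    by (rule finite_subset[of _ "A \<times> A"]) (use assms in auto)
  thus ?thesis
    using assms unfolding complete_digraph_def complete_digraph_on_def
    by (auto simp: arcs_ends_def arc_to_ends_def symmetric_def sym_def intro!: graph.intro
        digraph.intro pseudo_graph.intro fin_digraph.intro wf_digraph.intro
        fin_digraph_axioms.intro loopfree_digraph.intro loopfree_digraph_axioms.intro
        nomulti_digraph.intro nomulti_digraph_axioms.intro sym_digraph.intro
        sym_digraph_axioms.intro)
qed

text \<open>
  \<open>join G H\<close> and the library's \<open>union G H\<close> are only used for \<open>G\<close> and \<open>H\<close> with disjoint sets of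
  vertices, so that they are the join and the disjoint union.
\<close>

definition join :: "('a, 'a \<times> 'a) pre_digraph \<Rightarrow> ('a, 'a \<times> 'a) pre_digraph \<Rightarrow> ('a, 'a \<times> 'a) pre_digraph" where
  "join G H = (union G H)\<lparr>arcs := arcs G \<union> arcs H \<union> verts G \<times> verts H \<union> verts H \<times> verts G\<rparr>"

text \<open>
  The three complete digraphs live on consecutive intervals of lengths \<open>k\<close>, \<open>n - k - m\<close> and \<open>m\<close>.
  Meant for \<open>1 \<le> m \<le> n - k - 1\<close>.
\<close>

definition K_nkm :: "nat \<Rightarrow> nat \<Rightarrow> nat \<Rightarrow> (nat, nat \<times> nat) pre_digraph" where
  "K_nkm n k m =
     (let A = {0..<k}; B = {k..<n - m}; C = {n - m..<n};
          H = join (complete_digraph_on A) (union (complete_digraph_on B) (complete_digraph_on C))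
      in H\<lparr>arcs := arcs H \<union> C \<times> B\<rparr>)"

end

theory Submission
  imports Defs
begin

text \<open>
  Deleting \<open>k\<close> suitable arcs from \<open>G\<close> separates the vertices into two nonempty sides with no remaining
  arc from the first to the second. As \<open>k \<le> n - 2\<close> is too small for all pairs across the cut to be
  arcs, one can remove \<open>k\<close> vertices which hit every arc of the cut without exhausting either side
  (\<open>ex_missing_block\<close>). What is left of the two sides are sets \<open>B\<close> and \<open>C\<close> with no arc from \<open>B\<close> to
  \<open>C\<close>. Hence \<open>G\<close> is a spanning subgraph of the complete digraph without the arcs in \<open>B \<times> C\<close>, which
  is isomorphic to \<open>K(n,k,\<bar>C\<bar>)\<close>.

  In the latter digraph the distance is \<open>2\<close> on \<open>B \<times> C\<close> and \<open>1\<close> on all other pairs of distinct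
  vertices, and no distance in \<open>G\<close> is smaller. Its matrix has a positive eigenvector which is constant
  on \<open>B\<close> and off \<open>B\<close> (\<open>D_alpha_action_block_function\<close>), so its spectral radius is, up to a shift
  depending on \<open>n\<close> and \<open>\<alpha>\<close> only, the larger root of an explicit quadratic polynomial. The matrix of
  \<open>G\<close> stretches this vector by at least the eigenvalue, and by more at some vertex if \<open>G\<close> lacks a
  further arc. Comparison of a nonnegative matrix with a positive test vector
  (\<open>spectral_radius_gt_of_superinvariant\<close>) then gives
  \<open>\<mu>\<^sub>\<alpha>(G) \<ge> \<mu>\<^sub>\<alpha>(K(n,k,\<bar>C\<bar>))\<close> with equality only for isomorphic digraphs.

  It remains to minimise over \<open>c = \<bar>C\<bar>\<close> with \<open>\<bar>B\<bar> + \<bar>C\<bar> = n - k\<close> fixed. The sign of the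
  polynomial for \<open>c\<close> at the root for \<open>c = 1\<close> (\<open>block_poly_at_block_root_1\<close>) shows that the root is
  smallest at \<open>c = 1\<close>, strictly unless \<open>\<alpha> = 0\<close> and \<open>c = n - k - 1\<close>; for \<open>\<alpha> = 0\<close> the polynomial is
  symmetric in \<open>\<bar>B\<bar>\<close> and \<open>\<bar>C\<bar>\<close>.
\<close>

section \<open>Spectral radii of nonnegative matrices\<close>

text \<open>
  For an eigenvector \<open>z\<close>, take an index where \<open>cmod (z\<^sub>i) / x\<^sub>i\<close> is largest and replace every
  \<open>cmod (z\<^sub>j)\<close> in this row of the eigenvalue equation by its bound in terms of \<open>x\<^sub>j\<close>.
\<close>

lemma spectral_radius_le_of_subinvariant:
  fixes A :: "real mat" and x :: "nat \<Rightarrow> real"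
  assumes A: "A \<in> carrier_mat n n" and n: "n > 0"
    and nonneg: "\<And>i j. i < n \<Longrightarrow> j < n \<Longrightarrow> A $$ (i,j) \<ge> 0"
    and x: "\<And>i. i < n \<Longrightarrow> x i > 0"
    and sub: "\<And>i. i < n \<Longrightarrow> (\<Sum>j<n. A $$ (i,j) * x j) \<le> l * x i"
  shows "spectral_radius (map_mat complex_of_real A) \<le> l"
proof -
  let ?A = "map_mat complex_of_real A"
  have A': "?A \<in> carrier_mat n n" using A by simp
  obtain e where e: "e \<in> spectrum ?A" and rho: "spectral_radius ?A = cmod e"
    using spectral_radius_mem_max(1)[OF A' n] by auto
  obtain z where z: "z \<in> carrier_vec n" "z \<noteq> 0\<^sub>v n" and Az: "?A *\<^sub>v z = e \<cdot>\<^sub>v z"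
    using e A by (auto simp: spectrum_def eigenvalue_def eigenvector_def)
  define q where "q i = cmod (z $ i) / x i" for i
  have "Max (q ` {..<n}) \<in> q ` {..<n}" using n by (intro Max_in) auto
  then obtain i where i: "i < n" and qi: "Max (q ` {..<n}) = q i" by auto
  have qmax: "q j \<le> q i" if "j < n" for j
    unfolding qi[symmetric] using that by (intro Max_ge) auto
  have "\<exists>j<n. z $ j \<noteq> 0"
  proof (rule ccontr)
    assume "\<not> ?thesis"
    hence "z = 0\<^sub>v n" using z(1) by (intro eq_vecI) auto
    thus False using z(2) by simp
  qed
  then obtain j where j: "j < n" "z $ j \<noteq> 0" by auto
  have "0 < q j" using j x[OF j(1)] by (simp add: q_def)
  hence qpos: "0 < q i" using qmax[OF j(1)] by simp
  hence zi: "cmod (z $ i) > 0" using x[OF i] by (simp add: q_def zero_less_divide_iff)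
  have "e * z $ i = (\<Sum>j<n. complex_of_real (A $$ (i,j)) * z $ j)"
    using arg_cong[OF Az, of "\<lambda>v. v $ i"] i z(1) A
    by (simp add: scalar_prod_def atLeast0LessThan)
  hence "cmod e * cmod (z $ i) = cmod (\<Sum>j<n. complex_of_real (A $$ (i,j)) * z $ j)"
    by (metis norm_mult)
  also have "\<dots> \<le> (\<Sum>j<n. A $$ (i,j) * cmod (z $ j))"
    using norm_sum[of "\<lambda>j. complex_of_real (A $$ (i,j)) * z $ j" "{..<n}"] nonneg[OF i]
    by (auto simp: norm_mult intro!: order_trans[OF norm_sum] sum_mono)
  also have "\<dots> \<le> (\<Sum>j<n. A $$ (i,j) * (q i * x j))"
  proof (intro sum_mono mult_left_mono nonneg i)
    fix j assume "j \<in> {..<n}"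
    hence j: "j < n" by simp
    show "cmod (z $ j) \<le> q i * x j"
      using qmax[OF j] x[OF j] unfolding q_def[of j] by (simp add: pos_divide_le_eq)
  qed auto
  also have "\<dots> = q i * (\<Sum>j<n. A $$ (i,j) * x j)"
    by (simp add: sum_distrib_left mult_ac)
  also have "\<dots> \<le> q i * (l * x i)"
    using sub[OF i] qpos by (intro mult_left_mono) auto
  also have "\<dots> = l * cmod (z $ i)"
    using x[OF i] by (simp add: q_def)
  finally show ?thesis using zi rho by simp
qed

text \<open>
  If the spectral radius were below \<open>l\<close>, then \<open>A\<close> scaled by a number between the two would have
  bounded powers, whereas these powers stretch \<open>x\<close> at a geometric rate.
\<close>

lemma spectral_radius_ge_of_superinvariant:
  fixes A :: "real mat" and x :: "nat \<Rightarrow> real"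
  assumes A: "A \<in> carrier_mat n n" and n: "n > 0"
    and nonneg: "\<And>i j. i < n \<Longrightarrow> j < n \<Longrightarrow> A $$ (i,j) \<ge> 0"
    and x: "\<And>i. i < n \<Longrightarrow> x i > 0"
    and super: "\<And>i. i < n \<Longrightarrow> l * x i \<le> (\<Sum>j<n. A $$ (i,j) * x j)"
  shows "l \<le> spectral_radius (map_mat complex_of_real A)"
proof (rule ccontr)
  let ?A = "map_mat complex_of_real A"
  have A': "?A \<in> carrier_mat n n" using A by simp
  assume "\<not> ?thesis"
  hence lt: "spectral_radius ?A < l" by simp
  have "0 \<le> spectral_radius ?A" using spectral_radius_mem_max(1)[OF A' n] by auto
  define s where "s = (spectral_radius ?A + l) / 2"
  have s: "spectral_radius ?A < s" "s < l" "0 < s"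
    using lt \<open>0 \<le> spectral_radius ?A\<close> by (auto simp: s_def)
  define B where "B = (1 / s) \<cdot>\<^sub>m A"
  have B: "B \<in> carrier_mat n n" using A by (simp add: B_def)
  let ?B = "map_mat complex_of_real B"
  have B': "?B \<in> carrier_mat n n" using B by simp
  have "spectral_radius ?B < 1"
  proof -
    obtain e where e: "e \<in> spectrum ?B" and rho: "spectral_radius ?B = cmod e"
      using spectral_radius_mem_max(1)[OF B' n] by auto
    obtain z where z: "z \<in> carrier_vec n" "z \<noteq> 0\<^sub>v n" and Bz: "?B *\<^sub>v z = e \<cdot>\<^sub>v z"
      using e B by (auto simp: spectrum_def eigenvalue_def eigenvector_def)
    have "?A = complex_of_real s \<cdot>\<^sub>m ?B"
      using s(3) A by (intro eq_matI) (auto simp: B_def)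
    moreover have "(complex_of_real s \<cdot>\<^sub>m ?B) *\<^sub>v z = complex_of_real s \<cdot>\<^sub>v (?B *\<^sub>v z)"
      using z(1) B
      by (intro eq_vecI) (auto simp: scalar_prod_def sum_distrib_left mult.assoc)
    ultimately have "?A *\<^sub>v z = (complex_of_real s * e) \<cdot>\<^sub>v z"
      by (simp add: Bz smult_smult_assoc)
    hence "complex_of_real s * e \<in> spectrum ?A"
      using z A by (auto simp: spectrum_def eigenvalue_def eigenvector_def)
    hence "cmod (complex_of_real s * e) \<le> spectral_radius ?A"
      by (intro spectral_radius_mem_max(2)[OF A' n]) blast
    hence "s * cmod e \<le> spectral_radius ?A" using s(3) by (simp add: norm_mult)
    hence "s * cmod e < s * 1" using s(1) by linarith
    thus ?thesis using s(3) rho by (simp only: mult_less_cancel_left_pos)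
  qed
  then obtain c where c: "\<And>k. norm_bound (?B ^\<^sub>m k) c"
    using spectral_radius_jnf_norm_bound_less_1_upper_triangular[OF B'] by blast
  have hom: "?B ^\<^sub>m k = map_mat complex_of_real (B ^\<^sub>m k)" for k
    using B by (simp add: of_real_hom.mat_hom_pow)
  have Bk: "B ^\<^sub>m k \<in> carrier_mat n n" for k using B by simp
  have pow_nonneg: "(B ^\<^sub>m k) $$ (i,j) \<ge> 0" if "i < n" "j < n" for k i j
    using that
  proof (induction k arbitrary: j)
    case 0
    thus ?case using B by simp
  next
    case (Suc k)
    thus ?case using B Bk[of k] A s(3) nonneg
      by (auto simp: scalar_prod_def B_def intro!: sum_nonneg mult_nonneg_nonneg)
  qed
  have grow: "(l / s) ^ k * x i \<le> (\<Sum>j<n. (B ^\<^sub>m k) $$ (i,j) * x j)" if i: "i < n" for k i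
  proof (induction k)
    case 0
    have "(\<Sum>j<n. (B ^\<^sub>m 0) $$ (i,j) * x j) = (\<Sum>j<n. if i = j then x j else 0)"
      using i B by (intro sum.cong) auto
    thus ?case using i by simp
  next
    case (Suc k)
    have "(l / s) ^ Suc k * x i \<le> (l / s) * (\<Sum>j<n. (B ^\<^sub>m k) $$ (i,j) * x j)"
      using Suc s by (simp add: mult.assoc divide_right_mono mult_left_mono)
    also have "\<dots> = (\<Sum>j<n. (B ^\<^sub>m k) $$ (i,j) * (l * x j / s))"
      by (simp add: sum_distrib_left mult_ac)
    also have "\<dots> \<le> (\<Sum>j<n. (B ^\<^sub>m k) $$ (i,j) * (\<Sum>m<n. B $$ (j,m) * x m))"
    proof (intro sum_mono mult_left_mono pow_nonneg i)
      fix j assume "j \<in> {..<n}"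
      hence j: "j < n" by simp
      have "(\<Sum>m<n. B $$ (j,m) * x m) = (\<Sum>m<n. A $$ (j,m) * x m) / s"
        using A j by (simp add: B_def sum_divide_distrib)
      thus "l * x j / s \<le> (\<Sum>m<n. B $$ (j,m) * x m)"
        using super[OF j] s(3) by (simp add: divide_right_mono)
    qed auto
    also have "\<dots> = (\<Sum>j<n. \<Sum>m<n. (B ^\<^sub>m k) $$ (i,j) * B $$ (j,m) * x m)"
      by (simp add: sum_distrib_left mult.assoc)
    also have "\<dots> = (\<Sum>m<n. (\<Sum>j<n. (B ^\<^sub>m k) $$ (i,j) * B $$ (j,m)) * x m)"
      by (subst sum.swap) (simp add: sum_distrib_right)
    also have "\<dots> = (\<Sum>m<n. (B ^\<^sub>m Suc k) $$ (i,m) * x m)"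
      using B Bk[of k] i by (intro sum.cong) (auto simp: scalar_prod_def atLeast0LessThan)
    finally show ?case .
  qed
  have bound: "(l / s) ^ k \<le> c * (\<Sum>j<n. x j) / x 0" for k
  proof -
    have "(\<Sum>j<n. (B ^\<^sub>m k) $$ (0,j) * x j) \<le> (\<Sum>j<n. c * x j)"
    proof (intro sum_mono mult_right_mono)
      fix j assume "j \<in> {..<n}"
      hence j: "j < n" by simp
      have "cmod ((?B ^\<^sub>m k) $$ (0,j)) \<le> c"
        using c[of k] n j B' by (simp add: norm_bound_def)
      thus "(B ^\<^sub>m k) $$ (0,j) \<le> c" using n j carrier_matD[OF Bk[of k]] by (simp add: hom)
      show "0 \<le> x j" using x[OF j] by simp
    qed
    thus ?thesis using grow[OF n, of k] x[OF n]
      by (simp add: pos_le_divide_eq sum_distrib_left)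
  qed
  have "1 < l / s" using s by simp
  then obtain k where "c * (\<Sum>j<n. x j) / x 0 < (l / s) ^ k"
    using real_arch_pow by blast
  thus False using bound[of k] by simp
qed

lemma spectral_radius_eq_of_positive_eigenvector:
  fixes A :: "real mat" and x :: "nat \<Rightarrow> real"
  assumes "A \<in> carrier_mat n n" and "n > 0"
    and "\<And>i j. i < n \<Longrightarrow> j < n \<Longrightarrow> A $$ (i,j) \<ge> 0"
    and "\<And>i. i < n \<Longrightarrow> x i > 0"
    and "\<And>i. i < n \<Longrightarrow> (\<Sum>j<n. A $$ (i,j) * x j) = l * x i"
  shows "spectral_radius (map_mat complex_of_real A) = l"
  using assms
  by (intro antisym spectral_radius_le_of_subinvariant[where x = x]
      spectral_radius_ge_of_superinvariant[where x = x]) auto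

text \<open>
  The excess \<open>z = A x - l x\<close> is nonnegative and nonzero. Two indices are joined by a third one, hence
  \<open>A\<^sup>2 z\<close> is positive everywhere, and \<open>A\<^sup>2 x\<close> is a vector which \<open>A\<close> stretches by more than \<open>l\<close> in
  every entry.
\<close>

lemma spectral_radius_gt_of_superinvariant:
  fixes A :: "real mat" and x :: "nat \<Rightarrow> real"
  assumes A: "A \<in> carrier_mat n n" and n: "n \<ge> 3"
    and nonneg: "\<And>i j. i < n \<Longrightarrow> j < n \<Longrightarrow> A $$ (i,j) \<ge> 0"
    and pos: "\<And>i j. i < n \<Longrightarrow> j < n \<Longrightarrow> i \<noteq> j \<Longrightarrow> A $$ (i,j) > 0"
    and x: "\<And>i. i < n \<Longrightarrow> x i > 0"
    and super: "\<And>i. i < n \<Longrightarrow> l * x i \<le> (\<Sum>j<n. A $$ (i,j) * x j)"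
    and strict: "p < n" "l * x p < (\<Sum>j<n. A $$ (p,j) * x j)"
  shows "l < spectral_radius (map_mat complex_of_real A)"
proof -
  define T where "T f i = (\<Sum>j<n. A $$ (i,j) * f j)" for f and i :: nat
  define z where "z i = T x i - l * x i" for i
  have z: "0 \<le> z i" if "i < n" for i using super[OF that] by (simp add: z_def T_def)
  have zp: "0 < z p" using strict by (simp add: z_def T_def)
  have T_nonneg: "0 \<le> T f i" if "i < n" "\<And>j. j < n \<Longrightarrow> 0 \<le> f j" for f i
    unfolding T_def using that nonneg by (intro sum_nonneg mult_nonneg_nonneg) auto
  have T_pos: "0 < T f i"
    if "i < n" "j < n" "i \<noteq> j" "\<And>j. j < n \<Longrightarrow> 0 \<le> f j" "0 < f j" for f i j
    unfolding T_def using that nonneg pos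
    by (intro sum_pos2[of _ j] mult_nonneg_nonneg mult_pos_pos) auto
  have TTz: "0 < T (T z) i" if i: "i < n" for i
  proof -
    have "card {i, p} < card {0, 1, 2 :: nat}"
      using card_insert_le_m1[of 2 "{p}" i] by (simp add: card_insert_if)
    hence "\<not> {0, 1, 2} \<subseteq> {i, p}" using card_mono[of "{i,p}" "{0,1,2}"] by fastforce
    then obtain q where q: "q \<in> {0, 1, 2}" "q \<noteq> i" "q \<noteq> p" by blast
    have qn: "q < n" using q n by auto
    have "0 < T z q" using T_pos[OF qn strict(1) q(3)] z zp by blast
    thus ?thesis using T_pos[OF i qn, of "T z"] q T_nonneg z by blast
  qed
  have xpos: "0 < T f i" if i: "i < n" and f: "\<And>j. j < n \<Longrightarrow> 0 < f j" for f i
  proof -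
    define j :: nat where "j = (if i = 0 then 1 else 0)"
    have j: "j < n" "i \<noteq> j" using n by (auto simp: j_def)
    have "0 \<le> f j" if "j < n" for j using f[OF that] by simp
    thus ?thesis using T_pos[OF i j, of f] f[OF j(1)] by blast
  qed
  define y where "y = T (T x)"
  have y: "0 < y i" if "i < n" for i unfolding y_def using that x xpos by simp
  have lin: "T (\<lambda>j. T f j - l * f j) i = T (T f) i - l * T f i" for f i
    by (simp add: T_def algebra_simps sum_subtractf sum_distrib_left)
  have Ty: "T y i = l * y i + T (T z) i" for i
  proof -
    have "T z = (\<lambda>i. T (T x) i - l * T x i)"
      unfolding z_def[abs_def] using lin by blast
    thus ?thesis using lin[of "T x" i] by (simp add: y_def)
  qed
  define e where "e = Min ((\<lambda>i. T (T z) i / y i) ` {..<n})"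
  have ne: "{..<n} \<noteq> {}" using n by (auto simp: lessThan_empty_iff)
  have e: "0 < e" unfolding e_def using ne TTz y by (subst Min_gr_iff) auto
  have "l + e \<le> spectral_radius (map_mat complex_of_real A)"
  proof (rule spectral_radius_ge_of_superinvariant[OF A _ nonneg y])
    fix i assume i: "i < n"
    have "e \<le> T (T z) i / y i" unfolding e_def using i by (intro Min_le) auto
    hence "e * y i \<le> T (T z) i" using y[OF i] by (simp add: pos_le_divide_eq)
    thus "(l + e) * y i \<le> (\<Sum>j<n. A $$ (i,j) * y j)"
      using Ty[of i] by (simp add: T_def[of y] algebra_simps)
  qed (use n in auto)
  thus ?thesis using e by simp
qed

section \<open>The action of \<open>D\<^sub>\<alpha>\<close> on functions on the vertices\<close>

text \<open>
  The transmission on the diagonal is a sum of distances, too, so that each entry of the image is a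
  single sum which is linear in the distances.
\<close>

definition D_alpha_action :: "real \<Rightarrow> ('a \<Rightarrow> 'a \<Rightarrow> nat) \<Rightarrow> 'a set \<Rightarrow> ('a \<Rightarrow> real) \<Rightarrow> 'a \<Rightarrow> real" where
  "D_alpha_action \<alpha> d V f u = (\<Sum>v\<in>V. real (d u v) * (\<alpha> * f u + (1 - \<alpha>) * f v))"

lemma sum_D_alpha_mat:
  assumes "enumerates_verts G vs" "i < length vs"
  shows "(\<Sum>j<length vs. D_alpha_mat \<alpha> G vs $$ (i,j) * f (vs ! j)) =
    D_alpha_action \<alpha> (digraph_dist G) (verts G) f (vs ! i)"
proof -
  have d: "distinct vs" and V: "verts G = set vs" using assms by (auto simp: enumerates_verts_def)
  have bij: "bij_betw ((!) vs) {..<length vs} (verts G)"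
    using bij_betw_nth[OF d] V by simp
  let ?u = "vs ! i"
  have "(\<Sum>j<length vs. D_alpha_mat \<alpha> G vs $$ (i,j) * f (vs ! j)) =
      (\<Sum>j<length vs. (if ?u = vs ! j then \<alpha> * real (transmission G ?u) * f ?u else 0)
        + (1 - \<alpha>) * (real (digraph_dist G ?u (vs ! j)) * f (vs ! j)))"
    using assms(2) d by (intro sum.cong) (auto simp: D_alpha_mat_index algebra_simps)
  also have "\<dots> = (\<Sum>v\<in>verts G. (if ?u = v then \<alpha> * real (transmission G ?u) * f ?u else 0)
        + (1 - \<alpha>) * (real (digraph_dist G ?u v) * f v))"
    by (rule sum.reindex_bij_betw[OF bij])
  also have "\<dots> = \<alpha> * real (transmission G ?u) * f ?u
      + (1 - \<alpha>) * (\<Sum>v\<in>verts G. real (digraph_dist G ?u v) * f v)"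
    using assms(2) V by (simp add: sum.distrib sum_distrib_left)
  also have "\<dots> = D_alpha_action \<alpha> (digraph_dist G) (verts G) f ?u"
    by (simp add: D_alpha_action_def transmission_def sum_distrib_left sum_distrib_right
        sum.distrib[symmetric] algebra_simps)
  finally show ?thesis .
qed

lemma D_alpha_mat_nonneg:
  assumes "0 \<le> \<alpha>" "\<alpha> \<le> 1" "distinct vs" "i < length vs" "j < length vs"
  shows "0 \<le> D_alpha_mat \<alpha> G vs $$ (i,j)"
  using assms by (simp add: D_alpha_mat_index)

lemma D_alpha_spectral_radius_eq_of_positive_eigenfunction:
  assumes fin: "finite (verts G)" "verts G \<noteq> {}" and \<alpha>: "0 \<le> \<alpha>" "\<alpha> \<le> 1"
    and f: "\<And>u. u \<in> verts G \<Longrightarrow> 0 < f u"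
    and ev: "\<And>u. u \<in> verts G \<Longrightarrow> D_alpha_action \<alpha> (digraph_dist G) (verts G) f u = l * f u"
  shows "D_alpha_spectral_radius \<alpha> G = l"
proof -
  obtain vs where vs: "enumerates_verts G vs"
    using finite_distinct_list[OF fin(1)] by (auto simp: enumerates_verts_def)
  hence V: "distinct vs" "verts G = set vs" by (auto simp: enumerates_verts_def)
  show ?thesis
    unfolding D_alpha_spectral_radius_eq[OF vs]
  proof (rule spectral_radius_eq_of_positive_eigenvector[OF D_alpha_mat_carrier,
        where x = "\<lambda>i. f (vs ! i)"])
    show "0 < length vs" using fin V by auto
  qed (use \<alpha> V f ev vs in \<open>auto simp: D_alpha_mat_nonneg sum_D_alpha_mat\<close>)
qed

lemma D_alpha_spectral_radius_gt:
  assumes fin: "card (verts G) \<ge> 3" and \<alpha>: "0 \<le> \<alpha>" "\<alpha> < 1"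
    and dist: "\<And>u v. u \<in> verts G \<Longrightarrow> v \<in> verts G \<Longrightarrow> u \<noteq> v \<Longrightarrow> 0 < digraph_dist G u v"
    and f: "\<And>u. u \<in> verts G \<Longrightarrow> 0 < f u"
    and super: "\<And>u. u \<in> verts G \<Longrightarrow> l * f u \<le> D_alpha_action \<alpha> (digraph_dist G) (verts G) f u"
    and strict: "w \<in> verts G" "l * f w < D_alpha_action \<alpha> (digraph_dist G) (verts G) f w"
  shows "l < D_alpha_spectral_radius \<alpha> G"
proof -
  have "finite (verts G)" using fin by (metis card.infinite not_numeral_le_zero)
  then obtain vs where vs: "enumerates_verts G vs"
    using finite_distinct_list by (auto simp: enumerates_verts_def)
  hence V: "distinct vs" "verts G = set vs" by (auto simp: enumerates_verts_def)
  obtain p where p: "p < length vs" "vs ! p = w" using strict(1) V by (auto simp: in_set_conv_nth)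
  show ?thesis
    unfolding D_alpha_spectral_radius_eq[OF vs]
  proof (rule spectral_radius_gt_of_superinvariant[OF D_alpha_mat_carrier,
        where x = "\<lambda>i. f (vs ! i)" and p = p])
    show "3 \<le> length vs" using fin V distinct_card by metis
  next
    fix i j assume ij: "i < length vs" "j < length vs" "i \<noteq> j"
    hence "vs ! i \<noteq> vs ! j" using V by (simp add: nth_eq_iff_index_eq)
    thus "0 < D_alpha_mat \<alpha> G vs $$ (i,j)"
      using ij V \<alpha> dist[of "vs ! i" "vs ! j"] by (simp add: D_alpha_mat_index)
  qed (use \<alpha> V f vs super strict p in \<open>auto simp: D_alpha_mat_nonneg sum_D_alpha_mat\<close>)
qed

section \<open>Distances one and two\<close>

context wf_digraph
begin

lemma digraph_dist_le: "apath u p v \<Longrightarrow> digraph_dist G u v \<le> length p"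
  unfolding digraph_dist_def by (rule Least_le) blast

lemma ex_shortest_apath:
  assumes "u \<rightarrow>\<^sup>* v"
  shows "\<exists>p. apath u p v \<and> length p = digraph_dist G u v"
proof -
  obtain p where "apath u p v" using assms by (auto simp: reachable_apath)
  hence "\<exists>l p. apath u p v \<and> length p = l" by blast
  thus ?thesis unfolding digraph_dist_def by (rule LeastI_ex)
qed

lemma digraph_dist_self: "u \<in> verts G \<Longrightarrow> digraph_dist G u u = 0"
  using digraph_dist_le[of u "[]" u] by (simp add: apath_Nil_iff)

lemma digraph_dist_pos:
  assumes "u \<rightarrow>\<^sup>* v" "u \<noteq> v"
  shows "0 < digraph_dist G u v"
  using ex_shortest_apath[OF assms(1)] assms(2) by (metis apath_Nil_iff length_greater_0_conv)

lemma digraph_dist_ge_2: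
  assumes "u \<rightarrow>\<^sup>* v" "u \<noteq> v" "\<not> u \<rightarrow> v"
  shows "2 \<le> digraph_dist G u v"
proof -
  obtain p where p: "apath u p v" "length p = digraph_dist G u v"
    using ex_shortest_apath[OF assms(1)] by blast
  have "p \<noteq> []" using p assms(2) by (auto simp: apath_Nil_iff)
  then obtain e q where q: "p = e # q" by (cases p) auto
  have "q \<noteq> []"
  proof
    assume "q = []"
    hence "u \<rightarrow> v" using p(1) q by (auto simp: apath_def awalk_def arcs_ends_conv)
    thus False using assms(3) by simp
  qed
  thus ?thesis using p(2) q by (cases q) auto
qed

lemma digraph_dist_adj:
  assumes "u \<rightarrow> v" "u \<noteq> v"
  shows "digraph_dist G u v = 1"
proof -
  obtain e where e: "e \<in> arcs G" "tail G e = u" "head G e = v" using assms(1) by auto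
  hence "apath u [e] v" using assms(2) by (auto simp: apath_def awalk_def)
  hence "digraph_dist G u v \<le> 1" using digraph_dist_le by fastforce
  thus ?thesis using digraph_dist_pos[of u v] assms by simp
qed

lemma digraph_dist_eq_2:
  assumes "u \<rightarrow> w" "w \<rightarrow> v" "u \<noteq> v" "\<not> u \<rightarrow> v" "u \<noteq> w" "w \<noteq> v"
  shows "digraph_dist G u v = 2"
proof -
  obtain e where e: "e \<in> arcs G" "tail G e = u" "head G e = w" using assms(1) by auto
  obtain e' where e': "e' \<in> arcs G" "tail G e' = w" "head G e' = v" using assms(2) by auto
  have "apath u [e, e'] v" using assms e e' by (auto simp: apath_def awalk_def)
  hence "digraph_dist G u v \<le> 2" using digraph_dist_le by fastforce
  moreover have "u \<rightarrow>\<^sup>* v" using assms(1,2) by (meson reachable_adjI reachable_trans)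
  ultimately show ?thesis using digraph_dist_ge_2[of u v] assms by simp
qed

end

section \<open>Complete digraphs with one block of arcs removed\<close>

text \<open>
  For nonempty \<open>B\<close> and \<open>C\<close> these are the digraphs \<open>K(n,k,m)\<close> up to isomorphism: the \<open>k\<close> vertices
  outside \<open>B \<union> C\<close> are joined to all others, and \<open>m\<close> is the number of vertices of \<open>C\<close>.
\<close>

definition complete_minus_block :: "('a,'b) pre_digraph \<Rightarrow> 'a set \<Rightarrow> 'a set \<Rightarrow> bool" where
  "complete_minus_block G B C \<longleftrightarrow> B \<subseteq> verts G \<and> C \<subseteq> verts G \<and> B \<inter> C = {} \<and>
     arcs_ends G = {(u,v). u \<in> verts G \<and> v \<in> verts G \<and> u \<noteq> v} - B \<times> C"

definition block_dist :: "'a set \<Rightarrow> 'a set \<Rightarrow> 'a \<Rightarrow> 'a \<Rightarrow> nat" where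
  "block_dist B C u v = (if u = v then 0 else if u \<in> B \<and> v \<in> C then 2 else 1)"

lemma (in wf_digraph) digraph_dist_complete_minus_block:
  assumes blk: "complete_minus_block G B C" and hub: "verts G - (B \<union> C) \<noteq> {}"
    and uv: "u \<in> verts G" "v \<in> verts G"
  shows "digraph_dist G u v = block_dist B C u v"
proof -
  have adj: "x \<rightarrow> y \<longleftrightarrow> x \<in> verts G \<and> y \<in> verts G \<and> x \<noteq> y \<and> \<not> (x \<in> B \<and> y \<in> C)" for x y
    using blk by (auto simp: complete_minus_block_def)
  obtain w where w: "w \<in> verts G" "w \<notin> B" "w \<notin> C" using hub by auto
  consider "u = v" | "u \<noteq> v" "u \<in> B" "v \<in> C" | "u \<noteq> v" "\<not> (u \<in> B \<and> v \<in> C)" by blast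
  thus ?thesis
  proof cases
    case 1
    thus ?thesis using uv by (simp add: block_dist_def digraph_dist_self)
  next
    case 2
    hence "u \<rightarrow> w" "w \<rightarrow> v" "\<not> u \<rightarrow> v" "u \<noteq> w" "w \<noteq> v" using w uv by (auto simp: adj)
    thus ?thesis using digraph_dist_eq_2[of u w v] 2 by (simp add: block_dist_def)
  next
    case 3
    thus ?thesis using digraph_dist_adj[of u v] uv by (auto simp: block_dist_def adj)
  qed
qed

text \<open>
  For \<open>b = \<bar>B\<bar>\<close> and \<open>c = \<bar>C\<bar>\<close> this is the Perron eigenvalue up to the shift in \<open>block_eigenvalue\<close>; it
  is the larger root of \<open>block_poly\<close>, the characteristic polynomial of the quotient by the two classes
  \<open>B\<close> and \<open>verts G - B\<close> after the shift.
\<close>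

definition block_root :: "real \<Rightarrow> real \<Rightarrow> real \<Rightarrow> real \<Rightarrow> real" where
  "block_root \<alpha> n b c =
     (\<alpha> * c + (1 - \<alpha>) * n + sqrt ((\<alpha> * c - (1 - \<alpha>) * n)\<^sup>2 + 4 * (1 - \<alpha>) * b * c)) / 2"

definition block_poly :: "real \<Rightarrow> real \<Rightarrow> real \<Rightarrow> real \<Rightarrow> real \<Rightarrow> real" where
  "block_poly \<alpha> n b c t =
     t\<^sup>2 - (\<alpha> * c + (1 - \<alpha>) * n) * t + (1 - \<alpha>) * c * (\<alpha> * n - b)"

lemma block_poly_root:
  assumes "\<alpha> \<le> 1" "0 \<le> b" "0 \<le> c"
  shows "block_poly \<alpha> n b c (block_root \<alpha> n b c) = 0"
proof -
  define p r where "p = \<alpha> * c" and "r = (1 - \<alpha>) * n"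
  define q where "q = sqrt ((p - r)\<^sup>2 + 4 * (1 - \<alpha>) * b * c)"
  have q: "q\<^sup>2 = (p - r)\<^sup>2 + 4 * (1 - \<alpha>) * b * c"
    unfolding q_def using assms by (intro real_sqrt_pow2 add_nonneg_nonneg mult_nonneg_nonneg) auto
  have t: "block_root \<alpha> n b c = (p + r + q) / 2"
    by (simp add: block_root_def p_def r_def q_def)
  have "block_poly \<alpha> n b c (block_root \<alpha> n b c) =
      ((p + r + q) / 2)\<^sup>2 - (p + r) * ((p + r + q) / 2) + (p * r - (1 - \<alpha>) * b * c)"
    unfolding t by (simp add: block_poly_def p_def r_def algebra_simps)
  also have "\<dots> = (q\<^sup>2 - (p - r)\<^sup>2) / 4 - (1 - \<alpha>) * b * c"
    by (simp add: power2_eq_square field_simps)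
  finally show ?thesis using q by simp
qed

lemma block_root_gt:
  assumes "\<alpha> < 1" "0 < b" "0 < c"
  shows "\<alpha> * c < block_root \<alpha> n b c" "(1 - \<alpha>) * n < block_root \<alpha> n b c"
proof -
  define q where "q = sqrt ((\<alpha> * c - (1 - \<alpha>) * n)\<^sup>2 + 4 * (1 - \<alpha>) * b * c)"
  have "\<bar>\<alpha> * c - (1 - \<alpha>) * n\<bar> = sqrt ((\<alpha> * c - (1 - \<alpha>) * n)\<^sup>2)" by simp
  also have "\<dots> < q"
    unfolding q_def using assms by (intro real_sqrt_less_mono) simp
  finally have q: "\<alpha> * c - (1 - \<alpha>) * n < q" "(1 - \<alpha>) * n - \<alpha> * c < q"
    by (simp_all only: abs_less_iff minus_diff_eq)
  show "\<alpha> * c < block_root \<alpha> n b c"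
    unfolding block_root_def q_def[symmetric] using q(1) by simp
  show "(1 - \<alpha>) * n < block_root \<alpha> n b c"
    unfolding block_root_def q_def[symmetric] using q(2) by (simp add: algebra_simps)
qed

lemma le_block_root:
  assumes "\<alpha> \<le> 1" "0 \<le> b" "0 \<le> c"
  shows "block_poly \<alpha> n b c t \<le> 0 \<Longrightarrow> t \<le> block_root \<alpha> n b c"
    and "block_poly \<alpha> n b c t < 0 \<Longrightarrow> t < block_root \<alpha> n b c"
proof -
  let ?t = "block_root \<alpha> n b c"
  let ?s = "\<alpha> * c + (1 - \<alpha>) * n"
  have "block_poly \<alpha> n b c t = block_poly \<alpha> n b c t - block_poly \<alpha> n b c ?t"
    using block_poly_root[OF assms] by simp
  also have "\<dots> = (t - ?t) * (t + ?t - ?s)"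
    by (simp add: block_poly_def power2_eq_square algebra_simps)
  finally have fac: "block_poly \<alpha> n b c t = (t - ?t) * (t + ?t - ?s)" .
  have "0 \<le> (\<alpha> * c - (1 - \<alpha>) * n)\<^sup>2 + 4 * (1 - \<alpha>) * b * c"
    using assms by (intro add_nonneg_nonneg mult_nonneg_nonneg) auto
  hence half: "?s \<le> 2 * ?t" by (simp add: block_root_def)
  show "t \<le> ?t" if "block_poly \<alpha> n b c t \<le> 0"
  proof (rule ccontr)
    assume "\<not> ?thesis"
    hence "0 < (t - ?t) * (t + ?t - ?s)" using half by (intro mult_pos_pos) auto
    thus False using that fac by simp
  qed
  show "t < ?t" if "block_poly \<alpha> n b c t < 0"
  proof (rule ccontr)
    assume "\<not> ?thesis"
    hence "0 \<le> (t - ?t) * (t + ?t - ?s)" using half by (intro mult_nonneg_nonneg) auto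
    thus False using that fac by simp
  qed
qed

text \<open>
  With \<open>b + c = N\<close> fixed, the coefficients of the polynomials for \<open>c\<close> and for \<open>1\<close> differ by multiples
  of \<open>c - 1\<close>, and the second polynomial vanishes at the point in question. As the root exceeds
  \<open>(1 - \<alpha>) n\<close>, the sign of the value can be read off.
\<close>

lemma block_poly_at_block_root_1:
  assumes "\<alpha> \<le> 1" "1 \<le> N"
  shows "block_poly \<alpha> n (N - c) c (block_root \<alpha> n (N - 1) 1) =
    - ((c - 1) * (\<alpha> * (block_root \<alpha> n (N - 1) 1 - (1 - \<alpha>) * n) + (1 - \<alpha>) * (N - 1 - c)))"
proof -
  let ?t = "block_root \<alpha> n (N - 1) 1"
  have "block_poly \<alpha> n (N - c) c ?t = block_poly \<alpha> n (N - c) c ?t - block_poly \<alpha> n (N - 1) 1 ?t"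
    using block_poly_root[of \<alpha> "N - 1" 1 n] assms by simp
  also have "\<dots> = - ((c - 1) * (\<alpha> * (?t - (1 - \<alpha>) * n) + (1 - \<alpha>) * (N - 1 - c)))"
    by (simp add: block_poly_def algebra_simps)
  finally show ?thesis .
qed

lemma block_root_ge_block_root_1:
  assumes "0 \<le> \<alpha>" "\<alpha> < 1" "1 \<le> c" "c \<le> N - 1"
  shows "block_root \<alpha> n (N - 1) 1 \<le> block_root \<alpha> n (N - c) c"
    and "c \<noteq> 1 \<Longrightarrow> \<alpha> \<noteq> 0 \<or> c \<noteq> N - 1 \<Longrightarrow> block_root \<alpha> n (N - 1) 1 < block_root \<alpha> n (N - c) c"
proof -
  let ?t = "block_root \<alpha> n (N - 1) 1"
  have t: "0 < ?t - (1 - \<alpha>) * n" using block_root_gt(2)[of \<alpha> "N - 1" 1 n] assms by simp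
  define q where "q = \<alpha> * (?t - (1 - \<alpha>) * n) + (1 - \<alpha>) * (N - 1 - c)"
  have val: "block_poly \<alpha> n (N - c) c ?t = - ((c - 1) * q)"
    unfolding q_def using assms by (intro block_poly_at_block_root_1) auto
  have "0 \<le> q" unfolding q_def
    using t assms by (intro add_nonneg_nonneg mult_nonneg_nonneg) auto
  hence "0 \<le> (c - 1) * q" using assms by (intro mult_nonneg_nonneg) auto
  thus "?t \<le> block_root \<alpha> n (N - c) c"
    using assms val by (intro le_block_root(1)) auto
  assume c: "c \<noteq> 1" "\<alpha> \<noteq> 0 \<or> c \<noteq> N - 1"
  have "0 < q"
  proof (cases "\<alpha> = 0")
    case True
    thus ?thesis using c assms by (simp add: q_def)
  next
    case False
    have "0 < \<alpha> * (?t - (1 - \<alpha>) * n)" using False t assms by (intro mult_pos_pos) auto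
    moreover have "0 \<le> (1 - \<alpha>) * (N - 1 - c)" using assms by (intro mult_nonneg_nonneg) auto
    ultimately show ?thesis by (simp add: q_def)
  qed
  hence "0 < (c - 1) * q" using c assms by (intro mult_pos_pos) auto
  thus "?t < block_root \<alpha> n (N - c) c"
    using assms val by (intro le_block_root(2)) auto
qed

lemma block_root_0_swap: "block_root 0 n b c = block_root 0 n c b"
  by (simp add: block_root_def mult.commute mult.left_commute)

text \<open>
  The eigenfunction takes one value on \<open>B\<close> and the value \<open>1\<close> elsewhere. Outside \<open>B\<close> the eigenvalue
  equation reads \<open>t = (1 - \<alpha>) (n - b + b y)\<close>, and on \<open>B\<close> it reads
  \<open>t y = t + \<alpha> c y + (1 - \<alpha>) c\<close>; the second one determines \<open>y\<close>, and the first one is then the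
  quadratic equation for \<open>t\<close>.
\<close>

definition block_function :: "real \<Rightarrow> real \<Rightarrow> real \<Rightarrow> real \<Rightarrow> 'a set \<Rightarrow> 'a \<Rightarrow> real" where
  "block_function \<alpha> n b c B u =
     (let t = block_root \<alpha> n b c
      in if u \<in> B then (t + (1 - \<alpha>) * c) / (t - \<alpha> * c) else 1)"

definition block_eigenvalue :: "real \<Rightarrow> real \<Rightarrow> real \<Rightarrow> real \<Rightarrow> real" where
  "block_eigenvalue \<alpha> n b c = block_root \<alpha> n b c + \<alpha> * (n - 1) - (1 - \<alpha>)"

lemma block_function_pos:
  assumes "0 \<le> \<alpha>" "\<alpha> < 1" "0 < b" "0 < c"
  shows "0 < block_function \<alpha> n b c B u"
proof -
  have "\<alpha> * c < block_root \<alpha> n b c" "0 \<le> \<alpha> * c"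
    using block_root_gt(1)[of \<alpha> b c n] assms by auto
  moreover have "0 < (1 - \<alpha>) * c" using assms by simp
  ultimately have "0 < block_root \<alpha> n b c + (1 - \<alpha>) * c" "0 < block_root \<alpha> n b c - \<alpha> * c"
    by linarith+
  thus ?thesis by (simp add: block_function_def Let_def)
qed

lemma D_alpha_action_block_function:
  assumes fin: "finite V" and sub: "B \<subseteq> V" "C \<subseteq> V" "B \<inter> C = {}"
    and ne: "B \<noteq> {}" "C \<noteq> {}" and \<alpha>: "0 \<le> \<alpha>" "\<alpha> < 1" and u: "u \<in> V"
  defines "f \<equiv> block_function \<alpha> (card V) (card B) (card C) B"
  shows "D_alpha_action \<alpha> (block_dist B C) V f u =
    block_eigenvalue \<alpha> (card V) (card B) (card C) * f u"
proof -
  define n b c where "n = real (card V)" and "b = real (card B)" and "c = real (card C)"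
  define t where "t = block_root \<alpha> n b c"
  define y where "y = (t + (1 - \<alpha>) * c) / (t - \<alpha> * c)"
  have finB: "finite B" "finite C" using fin sub by (auto intro: finite_subset)
  have bc: "0 < b" "0 < c" using finB ne by (auto simp: b_def c_def card_gt_0_iff)
  have f: "f v = (if v \<in> B then y else 1)" for v
    by (simp add: f_def block_function_def y_def t_def n_def b_def c_def Let_def)
  have gt: "\<alpha> * c < t" unfolding t_def using block_root_gt(1) \<alpha> bc by blast
  have yt: "t * y = t + \<alpha> * c * y + (1 - \<alpha>) * c"
    using gt by (simp add: y_def field_simps)
  have S: "(\<Sum>v\<in>V. f v) = n - b + b * y"
  proof -
    have "(\<Sum>v\<in>V. f v) = (\<Sum>v\<in>B. f v) + (\<Sum>v\<in>V - B. f v)"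
      using sum.subset_diff[OF sub(1) fin, of f] by simp
    also have "\<dots> = b * y + real (card (V - B))"
      by (simp add: f b_def)
    finally show ?thesis using sub(1) finB fin card_mono[OF fin sub(1)]
      by (simp add: card_Diff_subset n_def b_def of_nat_diff)
  qed
  have St: "(1 - \<alpha>) * (n - b + b * y) = t"
  proof -
    have "t\<^sup>2 - (\<alpha> * c + (1 - \<alpha>) * n) * t + (1 - \<alpha>) * c * (\<alpha> * n - b) = 0"
      using block_poly_root[of \<alpha> b c n] \<alpha> bc by (simp add: block_poly_def t_def)
    hence "(t - \<alpha> * c) * t = (1 - \<alpha>) * ((n - b) * (t - \<alpha> * c) + b * (t + (1 - \<alpha>) * c))"
      by (simp add: power2_eq_square algebra_simps)
    also have "t + (1 - \<alpha>) * c = (t - \<alpha> * c) * y" using gt by (simp add: y_def)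
    finally have "(t - \<alpha> * c) * t = (t - \<alpha> * c) * ((1 - \<alpha>) * (n - b + b * y))"
      by (simp add: algebra_simps)
    thus ?thesis using gt by simp
  qed
  have "D_alpha_action \<alpha> (block_dist B C) V f u =
      (\<Sum>v\<in>V. (\<alpha> * f u + (1 - \<alpha>) * f v)
        - (if u = v then f u else 0)
        + (if v \<in> C then (if u \<in> B then \<alpha> * f u + (1 - \<alpha>) * f v else 0) else 0))"
    unfolding D_alpha_action_def using sub(3)
    by (intro sum.cong refl) (auto simp: block_dist_def algebra_simps)
  also have "\<dots> = n * (\<alpha> * f u) + (1 - \<alpha>) * (\<Sum>v\<in>V. f v) - f u
      + (\<Sum>v\<in>C. if u \<in> B then \<alpha> * f u + (1 - \<alpha>) * f v else 0)"
  proof -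
    have "(\<Sum>v\<in>V. if v \<in> C then (if u \<in> B then \<alpha> * f u + (1 - \<alpha>) * f v else 0) else 0) =
        (\<Sum>v\<in>C. if u \<in> B then \<alpha> * f u + (1 - \<alpha>) * f v else 0)"
      using sub(2) fin by (subst sum.inter_restrict[symmetric]) (auto simp: Int_absorb1)
    thus ?thesis using u fin
      by (simp add: sum.distrib sum_subtractf sum_distrib_left n_def)
  qed
  also have "(\<Sum>v\<in>C. if u \<in> B then \<alpha> * f u + (1 - \<alpha>) * f v else 0) =
      (if u \<in> B then c * (\<alpha> * y + (1 - \<alpha>)) else 0)"
  proof -
    have "f v = 1" if "v \<in> C" for v using that sub(3) by (auto simp: f)
    thus ?thesis by (simp add: c_def f)
  qed
  also have "(1 - \<alpha>) * (\<Sum>v\<in>V. f v) = t" using S St by simp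
  also have "n * (\<alpha> * f u) + t - f u + (if u \<in> B then c * (\<alpha> * y + (1 - \<alpha>)) else 0) =
      (t + \<alpha> * (n - 1) - (1 - \<alpha>)) * f u"
    using yt by (cases "u \<in> B") (simp_all add: f algebra_simps)
  finally show ?thesis by (simp add: block_eigenvalue_def t_def n_def b_def c_def)
qed

lemma (in fin_digraph) D_alpha_spectral_radius_complete_minus_block:
  assumes blk: "complete_minus_block G B C" and hub: "verts G - (B \<union> C) \<noteq> {}"
    and ne: "B \<noteq> {}" "C \<noteq> {}" and \<alpha>: "0 \<le> \<alpha>" "\<alpha> < 1"
  shows "D_alpha_spectral_radius \<alpha> G = block_eigenvalue \<alpha> (card (verts G)) (card B) (card C)"
proof (rule D_alpha_spectral_radius_eq_of_positive_eigenfunction)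
  let ?f = "block_function \<alpha> (card (verts G)) (card B) (card C) B"
  have sub: "B \<subseteq> verts G" "C \<subseteq> verts G" "B \<inter> C = {}"
    using blk by (auto simp: complete_minus_block_def)
  hence "finite B" "finite C" by (auto intro: finite_subset)
  hence bc: "0 < card B" "0 < card C" using ne by (auto simp: card_gt_0_iff)
  show "0 < ?f u" for u using bc \<alpha> by (intro block_function_pos) auto
  fix u assume u: "u \<in> verts G"
  have "D_alpha_action \<alpha> (digraph_dist G) (verts G) ?f u =
      D_alpha_action \<alpha> (block_dist B C) (verts G) ?f u"
    unfolding D_alpha_action_def
    by (intro sum.cong) (simp_all add: digraph_dist_complete_minus_block[OF blk hub u])
  thus "D_alpha_action \<alpha> (digraph_dist G) (verts G) ?f u =
      block_eigenvalue \<alpha> (card (verts G)) (card B) (card C) * ?f u"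
    using D_alpha_action_block_function[OF finite_verts sub ne \<alpha> u] by simp
qed (use hub \<alpha> in auto)

text \<open>
  No distance is smaller than in the complete digraph without the block, and a missing further arc
  makes one of them larger. So the Perron eigenfunction of the latter digraph is stretched by at
  least its eigenvalue.
\<close>

lemma (in digraph) D_alpha_spectral_radius_gt_block_eigenvalue:
  assumes sc: "strongly_connected G" and n: "3 \<le> card (verts G)"
    and sub: "B \<subseteq> verts G" "C \<subseteq> verts G" "B \<inter> C = {}"
    and ne: "B \<noteq> {}" "C \<noteq> {}" and \<alpha>: "0 \<le> \<alpha>" "\<alpha> < 1"
    and no_arc: "\<And>u v. u \<in> B \<Longrightarrow> v \<in> C \<Longrightarrow> \<not> u \<rightarrow> v"
    and not_blk: "\<not> complete_minus_block G B C"
  shows "block_eigenvalue \<alpha> (card (verts G)) (card B) (card C) < D_alpha_spectral_radius \<alpha> G"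
proof -
  let ?f = "block_function \<alpha> (card (verts G)) (card B) (card C) B"
  let ?l = "block_eigenvalue \<alpha> (card (verts G)) (card B) (card C)"
  have "finite B" "finite C" using sub by (auto intro: finite_subset)
  hence bc: "0 < card B" "0 < card C" using ne by (auto simp: card_gt_0_iff)
  have f: "0 < ?f u" for u using bc \<alpha> by (intro block_function_pos) auto
  have reach: "u \<rightarrow>\<^sup>* v" if "u \<in> verts G" "v \<in> verts G" for u v
    using sc that by (auto simp: strongly_connected_def)
  have dist: "block_dist B C u v \<le> digraph_dist G u v" if "u \<in> verts G" "v \<in> verts G" for u v
    using digraph_dist_pos[OF reach[OF that]] digraph_dist_ge_2[OF reach[OF that]] no_arc
    by (auto simp: block_dist_def Suc_le_eq)
  have coeff: "0 < \<alpha> * ?f u + (1 - \<alpha>) * ?f v" for u v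
    using f[of u] f[of v] \<alpha> by (intro add_nonneg_pos mult_nonneg_nonneg mult_pos_pos) auto
  have eig: "D_alpha_action \<alpha> (block_dist B C) (verts G) ?f u = ?l * ?f u" if "u \<in> verts G" for u
    using D_alpha_action_block_function[OF finite_verts sub ne \<alpha> that] .
  have "arcs_ends G \<subseteq> {(u,v). u \<in> verts G \<and> v \<in> verts G \<and> u \<noteq> v} - B \<times> C"
    using no_arc by (auto simp: adj_in_verts dest: adj_not_same)
  then obtain w z where wz: "w \<in> verts G" "z \<in> verts G" "w \<noteq> z" "\<not> (w \<in> B \<and> z \<in> C)" "\<not> w \<rightarrow> z"
    using not_blk sub unfolding complete_minus_block_def by blast
  have dwz: "block_dist B C w z < digraph_dist G w z"
    using digraph_dist_ge_2[OF reach[OF wz(1,2)] wz(3,5)] wz by (auto simp: block_dist_def)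
  show ?thesis
  proof (rule D_alpha_spectral_radius_gt[OF n \<alpha>, where f = ?f])
    show "0 < digraph_dist G u v" if "u \<in> verts G" "v \<in> verts G" "u \<noteq> v" for u v
      using digraph_dist_pos reach that by blast
    show "?l * ?f u \<le> D_alpha_action \<alpha> (digraph_dist G) (verts G) ?f u" if "u \<in> verts G" for u
      unfolding eig[OF that, symmetric] D_alpha_action_def
      using dist that less_imp_le[OF coeff] by (intro sum_mono mult_right_mono) auto
    show "?l * ?f w < D_alpha_action \<alpha> (digraph_dist G) (verts G) ?f w"
      unfolding eig[OF wz(1), symmetric] D_alpha_action_def
    proof (rule sum_strict_mono_ex1)
      show "\<forall>v\<in>verts G. real (block_dist B C w v) * (\<alpha> * ?f w + (1 - \<alpha>) * ?f v)
          \<le> real (digraph_dist G w v) * (\<alpha> * ?f w + (1 - \<alpha>) * ?f v)"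
        using dist wz(1) less_imp_le[OF coeff] by (intro ballI mult_right_mono) auto
      show "\<exists>v\<in>verts G. real (block_dist B C w v) * (\<alpha> * ?f w + (1 - \<alpha>) * ?f v)
          < real (digraph_dist G w v) * (\<alpha> * ?f w + (1 - \<alpha>) * ?f v)"
        using dwz wz(2) coeff[of w z] by (intro bexI[of _ z] mult_strict_right_mono) auto
    qed simp
  qed (use f wz in auto)
qed

section \<open>The digraphs \<open>K(n,k,m)\<close>\<close>

lemma K_nkm_simps:
  assumes "1 \<le> m" "m \<le> n - k - 1"
  shows "verts (K_nkm n k m) = {0..<n}"
    and "arcs (K_nkm n k m) =
      {(u,v). u < n \<and> v < n \<and> u \<noteq> v} - {k..<n - m} \<times> {n - m..<n}"
    and "tail (K_nkm n k m) = fst" "head (K_nkm n k m) = snd"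
  using assms
  by (auto simp: K_nkm_def join_def union_def complete_digraph_on_def Let_def)

lemma arcs_ends_K_nkm:
  assumes "1 \<le> m" "m \<le> n - k - 1"
  shows "arcs_ends (K_nkm n k m) = arcs (K_nkm n k m)"
  by (simp add: arcs_ends_conv K_nkm_simps[OF assms])

lemma complete_minus_block_K_nkm:
  assumes "1 \<le> m" "m \<le> n - k - 1"
  shows "complete_minus_block (K_nkm n k m) {k..<n - m} {n - m..<n}"
  using assms by (auto simp: complete_minus_block_def arcs_ends_K_nkm K_nkm_simps)

lemma fin_digraph_K_nkm:
  assumes "1 \<le> m" "m \<le> n - k - 1"
  shows "fin_digraph (K_nkm n k m)"
proof
  have "arcs (K_nkm n k m) \<subseteq> {0..<n} \<times> {0..<n}" by (auto simp: K_nkm_simps[OF assms])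
  thus "finite (arcs (K_nkm n k m))" by (rule finite_subset) simp
qed (auto simp: K_nkm_simps[OF assms])

lemma D_alpha_spectral_radius_K_nkm:
  assumes "1 \<le> k" "1 \<le> m" "m \<le> n - k - 1" "0 \<le> \<alpha>" "\<alpha> < 1"
  shows "D_alpha_spectral_radius \<alpha> (K_nkm n k m) = block_eigenvalue \<alpha> n (n - k - m) m"
proof -
  interpret fin_digraph "K_nkm n k m" using fin_digraph_K_nkm assms by blast
  have "0 \<in> verts (K_nkm n k m) - ({k..<n - m} \<union> {n - m..<n})"
    using assms by (auto simp: K_nkm_simps)
  hence hub: "verts (K_nkm n k m) - ({k..<n - m} \<union> {n - m..<n}) \<noteq> {}" by blast
  have "card {k..<n - m} = n - k - m" "card {n - m..<n} = m" using assms by auto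
  thus ?thesis
    using D_alpha_spectral_radius_complete_minus_block[OF complete_minus_block_K_nkm hub] assms
    by (simp add: K_nkm_simps)
qed

text \<open>
  Any bijection which maps the hub \<open>verts G - (B \<union> C)\<close>, \<open>B\<close> and \<open>C\<close> onto the three intervals of
  \<open>K(n,k,m)\<close> is an isomorphism; as \<open>G\<close> has no multiple arcs, it is injective on the arcs, too.
\<close>

lemma digraph_iso_K_nkm_of_complete_minus_block:
  fixes G :: "('a,'b) pre_digraph"
  assumes G: "digraph G" and blk: "complete_minus_block G B C"
    and n: "card (verts G) = n" and k: "card (verts G - (B \<union> C)) = k" and m: "card C = m"
    and ne: "B \<noteq> {}" "C \<noteq> {}"
  shows "digraph_iso G (K_nkm n k m)"
proof -
  interpret digraph G by (rule G)
  let ?A = "verts G - (B \<union> C)"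
  have sub: "B \<subseteq> verts G" "C \<subseteq> verts G" "B \<inter> C = {}"
    and ends: "arcs_ends G = {(u,v). u \<in> verts G \<and> v \<in> verts G \<and> u \<noteq> v} - B \<times> C"
    using blk by (auto simp: complete_minus_block_def)
  have fin: "finite ?A" "finite B" "finite C" using sub by (auto intro: finite_subset)
  have "card (B \<union> C) = card B + m" using fin sub m by (simp add: card_Un_disjoint)
  moreover have "card ?A + card (B \<union> C) = n"
    using sub n card_Diff_subset[of "B \<union> C" "verts G"] fin
      card_mono[of "verts G" "B \<union> C"] by simp
  ultimately have cards: "k + card B + m = n" using k by simp
  have m1: "1 \<le> m" "1 \<le> card B" using ne fin m by (auto simp: Suc_le_eq card_gt_0_iff)
  have m2: "m \<le> n - k - 1" using cards m1 by simp
  obtain hA where hA: "bij_betw hA ?A {0..<k}"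
    using fin k by (metis ex_bij_betw_finite_nat)
  have "\<exists>h. bij_betw h B {k..<n - m}"
    using fin cards by (intro finite_same_card_bij) auto
  then obtain hB where hB: "bij_betw hB B {k..<n - m}" by blast
  have "\<exists>h. bij_betw h C {n - m..<n}"
    using fin cards m by (intro finite_same_card_bij) auto
  then obtain hC where hC: "bij_betw hC C {n - m..<n}" by blast
  define h where "h u = (if u \<in> C then hC u else if u \<in> B then hB u else hA u)" for u
  have bA: "bij_betw h ?A {0..<k}" using hA by (subst bij_betw_cong[where g = hA]) (auto simp: h_def)
  have bB: "bij_betw h B {k..<n - m}"
    using hB sub(3) by (subst bij_betw_cong[where g = hB]) (auto simp: h_def)
  have bC: "bij_betw h C {n - m..<n}"
    using hC by (subst bij_betw_cong[where g = hC]) (auto simp: h_def)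
  have "bij_betw h (?A \<union> B) ({0..<k} \<union> {k..<n - m})"
    using bA bB by (rule bij_betw_combine) auto
  hence "bij_betw h (?A \<union> B \<union> C) ({0..<k} \<union> {k..<n - m} \<union> {n - m..<n})"
    using bC by (rule bij_betw_combine) (use cards in auto)
  moreover have "?A \<union> B \<union> C = verts G" using sub by blast
  moreover have "{0..<k} \<union> {k..<n - m} \<union> {n - m..<n} = {0..<n}" using cards by auto
  ultimately have bij: "bij_betw h (verts G) {0..<n}" by simp
  hence inj: "inj_on h (verts G)" by (simp add: bij_betw_def)
  have hB_iff: "h u \<in> {k..<n - m} \<longleftrightarrow> u \<in> B" if "u \<in> verts G" for u
    using that bij_betw_imp_surj_on[OF bB] inj sub(1) by (metis inj_on_image_mem_iff)
  have hC_iff: "h u \<in> {n - m..<n} \<longleftrightarrow> u \<in> C" if "u \<in> verts G" for u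
    using that bij_betw_imp_surj_on[OF bC] inj sub(2) by (metis inj_on_image_mem_iff)
  define f where "f = \<lparr>iso_verts = h, iso_arcs = (\<lambda>e. (h (tail G e), h (head G e))),
      iso_head = snd, iso_tail = fst\<rparr>"
  have "inj_on (\<lambda>e. (h (tail G e), h (head G e))) (arcs G)"
  proof (rule inj_onI)
    fix e e' assume e: "e \<in> arcs G" "e' \<in> arcs G"
      and "(h (tail G e), h (head G e)) = (h (tail G e'), h (head G e'))"
    hence "tail G e = tail G e'" "head G e = head G e'"
      using inj by (auto dest: inj_onD)
    thus "e = e'" using e by (intro no_multi_arcs) (auto simp: arc_to_ends_def)
  qed
  hence "digraph_isomorphism f"
    using inj by (auto simp: digraph_isomorphism_def f_def wf_digraph)
  moreover have "K_nkm n k m = app_iso f G"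
  proof (rule pre_digraph.equality)
    show "verts (K_nkm n k m) = verts (app_iso f G)"
      using bij by (simp add: K_nkm_simps[OF m1(1) m2] f_def bij_betw_def)
    have "arcs (app_iso f G) = (\<lambda>(u,v). (h u, h v)) ` arcs_ends G"
      by (auto simp: f_def arcs_ends_conv image_image)
    also have "\<dots> = arcs (K_nkm n k m)"
    proof (intro equalityI subsetI)
      fix p assume "p \<in> (\<lambda>(u,v). (h u, h v)) ` arcs_ends G"
      then obtain u v where uv: "p = (h u, h v)" "u \<in> verts G" "v \<in> verts G" "u \<noteq> v"
        "\<not> (u \<in> B \<and> v \<in> C)" by (auto simp: ends)
      have "h u < n" "h v < n" using uv bij by (auto simp: bij_betw_def)
      moreover have "h u \<noteq> h v" using uv inj by (auto dest: inj_onD)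
      ultimately show "p \<in> arcs (K_nkm n k m)"
        unfolding K_nkm_simps[OF m1(1) m2] using uv hB_iff hC_iff by auto
    next
      fix p assume "p \<in> arcs (K_nkm n k m)"
      then obtain x y where xy: "p = (x, y)" "x < n" "y < n" "x \<noteq> y"
        "\<not> (x \<in> {k..<n - m} \<and> y \<in> {n - m..<n})"
        unfolding K_nkm_simps[OF m1(1) m2] by blast
      have "x \<in> h ` verts G" "y \<in> h ` verts G" using xy bij by (auto simp: bij_betw_def)
      then obtain u v where uv: "u \<in> verts G" "v \<in> verts G" "x = h u" "y = h v" by blast
      have "(u, v) \<in> arcs_ends G"
        unfolding ends using uv xy hB_iff hC_iff by auto
      thus "p \<in> (\<lambda>(u,v). (h u, h v)) ` arcs_ends G" using uv xy by force
    qed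
    finally show "arcs (K_nkm n k m) = arcs (app_iso f G)" by simp
  qed (simp_all add: K_nkm_simps[OF m1(1) m2] f_def)
  ultimately show ?thesis unfolding digraph_iso_def by blast
qed

lemma complete_minus_block_of_digraph_iso_K_nkm:
  fixes G :: "('a,'b) pre_digraph"
  assumes G: "wf_digraph G" and iso: "digraph_iso G (K_nkm n k m)"
    and m: "1 \<le> m" "m \<le> n - k - 1"
  obtains B C where "complete_minus_block G B C" "card (verts G) = n"
    "card B = n - k - m" "card C = m"
proof -
  interpret wf_digraph G by (rule G)
  obtain f where f: "digraph_isomorphism f" and K: "K_nkm n k m = app_iso f G"
    using iso unfolding digraph_iso_def by blast
  define h where "h = iso_verts f"
  have inj: "inj_on h (verts G)" using f by (simp add: digraph_isomorphism_def h_def)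
  have "h ` verts G = {0..<n}" using K K_nkm_simps(1)[OF m] by (simp add: h_def)
  hence bij: "bij_betw h (verts G) {0..<n}" using inj by (simp add: bij_betw_def)
  have fst_snd: "iso_tail f = fst" "iso_head f = snd"
    using K K_nkm_simps(3,4)[OF m] by (metis tail_app_iso, metis head_app_iso)
  have iso_arc: "iso_arcs f e = (h (tail G e), h (head G e))" if "e \<in> arcs G" for e
    using iso_verts_tail[OF f that] iso_verts_head[OF f that] fst_snd
    by (simp add: h_def prod_eq_iff)
  have arcs: "arcs (K_nkm n k m) = (\<lambda>(u,v). (h u, h v)) ` arcs_ends G"
    unfolding K arcs_app_iso arcs_ends_conv image_image
    by (rule image_cong) (auto simp: iso_arc)
  have adj: "u \<rightarrow>\<^bsub>G\<^esub> v \<longleftrightarrow> (h u, h v) \<in> arcs (K_nkm n k m)" if uv: "u \<in> verts G" "v \<in> verts G" for u v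
  proof
    assume "(h u, h v) \<in> arcs (K_nkm n k m)"
    then obtain u' v' where "u' \<rightarrow>\<^bsub>G\<^esub> v'" "h u = h u'" "h v = h v'" unfolding arcs by auto
    moreover from this have "u = u'" "v = v'"
      using inj uv adj_in_verts by (auto dest: inj_onD)
    ultimately show "u \<rightarrow>\<^bsub>G\<^esub> v" by simp
  qed (force simp: arcs)
  define B where "B = {u \<in> verts G. h u \<in> {k..<n - m}}"
  define C where "C = {u \<in> verts G. h u \<in> {n - m..<n}}"
  have preimage: "card {u \<in> verts G. h u \<in> X} = card X" if "X \<subseteq> {0..<n}" for X
  proof -
    have "h ` {u \<in> verts G. h u \<in> X} = X" using bij that by (auto simp: bij_betw_def)
    moreover have "inj_on h {u \<in> verts G. h u \<in> X}" using inj by (rule inj_on_subset) auto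
    ultimately show ?thesis by (metis card_image)
  qed
  have "card B = n - k - m" unfolding B_def by (subst preimage) auto
  moreover have "card C = m" unfolding C_def using m by (subst preimage) auto
  moreover have "card (verts G) = n" using bij_betw_same_card[OF bij] by simp
  moreover have "complete_minus_block G B C"
  proof -
    have "u \<rightarrow>\<^bsub>G\<^esub> v \<longleftrightarrow> u \<noteq> v \<and> \<not> (u \<in> B \<and> v \<in> C)" if uv: "u \<in> verts G" "v \<in> verts G" for u v
    proof -
      have "h u < n" "h v < n" using uv bij by (auto simp: bij_betw_def)
      moreover have "h u = h v \<longleftrightarrow> u = v" using uv inj by (auto dest: inj_onD)
      ultimately show ?thesis
        unfolding adj[OF uv] K_nkm_simps(2)[OF m] B_def C_def using uv by auto
    qed
    hence "u \<rightarrow>\<^bsub>G\<^esub> v \<longleftrightarrow> u \<in> verts G \<and> v \<in> verts G \<and> u \<noteq> v \<and> \<not> (u \<in> B \<and> v \<in> C)" for u v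
      using adj_in_verts by blast
    hence "arcs_ends G = {(u,v). u \<in> verts G \<and> v \<in> verts G \<and> u \<noteq> v} - B \<times> C" by auto
    moreover have "B \<subseteq> verts G" "C \<subseteq> verts G" "B \<inter> C = {}" by (auto simp: B_def C_def)
    ultimately show ?thesis unfolding complete_minus_block_def by blast
  qed
  ultimately show ?thesis using that by blast
qed

section \<open>From an arc cut to a missing block\<close>

lemma ex_arc_cut:
  assumes G: "digraph G" and n: "2 \<le> card (verts G)" and k: "arc_connectivity G = k"
  obtains S X where "S \<subseteq> arcs G" "card S = k" "X \<subset> verts G" "X \<noteq> {}"
    "\<And>e. e \<in> arcs G \<Longrightarrow> tail G e \<in> X \<Longrightarrow> head G e \<notin> X \<Longrightarrow> e \<in> S"
proof -
  interpret digraph G by (rule G)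
  let ?del = "\<lambda>S. G\<lparr>arcs := arcs G - S\<rparr>"
  have wf: "wf_digraph (?del S)" for S by unfold_locales auto
  \<comment> \<open>Deleting all arcs works, so the minimum in the definition of the arc connectivity is attained.\<close>
  have "\<not> strongly_connected (?del (arcs G))"
  proof
    assume sc: "strongly_connected (?del (arcs G))"
    obtain u v where "u \<in> verts G" "v \<in> verts G" "u \<noteq> v"
      using n card_le_Suc0_iff_eq[of "verts G"] by fastforce
    hence "(u, v) \<in> (arcs_ends (?del (arcs G)))\<^sup>*" "u \<noteq> v"
      using sc by (auto simp: strongly_connected_def intro: reachable_rtranclI)
    thus False by (simp add: arcs_ends_def)
  qed
  hence "\<exists>k. \<exists>S\<subseteq>arcs G. card S = k \<and> \<not> strongly_connected (?del S)" by blast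
  hence "\<exists>S\<subseteq>arcs G. card S = k \<and> \<not> strongly_connected (?del S)"
    unfolding k[symmetric] arc_connectivity_def by (rule LeastI_ex)
  then obtain S where S: "S \<subseteq> arcs G" "card S = k" "\<not> strongly_connected (?del S)" by blast
  interpret D: wf_digraph "?del S" by (rule wf)
  have "verts G \<noteq> {}" using n by auto
  then obtain u v where uv: "u \<in> verts G" "v \<in> verts G" "\<not> u \<rightarrow>\<^sup>*\<^bsub>?del S\<^esub> v"
    using S(3) by (auto simp: strongly_connected_def)
  define X where "X = {w. u \<rightarrow>\<^sup>*\<^bsub>?del S\<^esub> w}"
  have "X \<subseteq> verts G" using D.reachable_in_verts by (auto simp: X_def)
  moreover have "v \<notin> X" using uv by (simp add: X_def)
  moreover have "u \<in> X" using uv D.reachable_refl[of u] by (simp add: X_def)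
  moreover have "e \<in> S" if e: "e \<in> arcs G" "tail G e \<in> X" "head G e \<notin> X" for e
  proof (rule ccontr)
    assume "e \<notin> S"
    hence "tail G e \<rightarrow>\<^bsub>?del S\<^esub> head G e" using e by (force simp: arcs_ends_conv)
    hence "u \<rightarrow>\<^sup>*\<^bsub>?del S\<^esub> head G e" using e(2) D.reachable_adj_trans by (auto simp: X_def)
    thus False using e(3) by (simp add: X_def)
  qed
  ultimately show ?thesis using that S uv by blast
qed

text \<open>
  Since \<open>\<bar>X\<bar> \<bar>Y\<bar> \<ge> n - 1 > k\<close> for the two sides \<open>X\<close>, \<open>Y\<close> of the cut, some \<open>u \<in> X\<close> has no arc to some
  \<open>v \<in> Y\<close>. Every arc of the cut has an end other than \<open>u\<close> and \<open>v\<close>. Deleting one such end per arc,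
  and further vertices until \<open>k\<close> are gone, leaves two nonempty sets without arcs between them.
\<close>

lemma ex_missing_block:
  assumes G: "digraph G" and k: "k \<le> card (verts G) - 2" and n: "2 \<le> card (verts G)"
    and con: "arc_connectivity G = k"
  obtains B C where "B \<subseteq> verts G" "C \<subseteq> verts G" "B \<inter> C = {}" "B \<noteq> {}" "C \<noteq> {}"
    "card (verts G - (B \<union> C)) = k" "\<And>u v. u \<in> B \<Longrightarrow> v \<in> C \<Longrightarrow> (u,v) \<notin> arcs_ends G"
proof -
  interpret digraph G by (rule G)
  obtain S X where S: "S \<subseteq> arcs G" "card S = k" and X: "X \<subset> verts G" "X \<noteq> {}"
    and cut: "\<And>e. e \<in> arcs G \<Longrightarrow> tail G e \<in> X \<Longrightarrow> head G e \<notin> X \<Longrightarrow> e \<in> S"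
    using ex_arc_cut[OF G n con] by blast
  define Y where "Y = verts G - X"
  have Y: "Y \<noteq> {}" "Y \<subseteq> verts G" "X \<inter> Y = {}" using X by (auto simp: Y_def)
  have fin: "finite S" "finite X" "finite Y"
    using S X by (auto simp: Y_def intro: finite_subset[of S "arcs G"] finite_subset[of X "verts G"])
  have xy: "card X + card Y = card (verts G)"
    using X fin card_mono[of "verts G" X] by (simp add: Y_def card_Diff_subset psubset_imp_subset)
  have "\<exists>u\<in>X. \<exists>v\<in>Y. \<not> u \<rightarrow>\<^bsub>G\<^esub> v"
  proof (rule ccontr)
    assume "\<not> ?thesis"
    hence all: "\<And>u v. u \<in> X \<Longrightarrow> v \<in> Y \<Longrightarrow> u \<rightarrow>\<^bsub>G\<^esub> v" by blast
    have "X \<times> Y \<subseteq> (\<lambda>e. (tail G e, head G e)) ` S"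
    proof
      fix p assume "p \<in> X \<times> Y"
      then obtain u v where p: "p = (u,v)" "u \<in> X" "v \<in> Y" by blast
      then obtain e where "e \<in> arcs G" "tail G e = u" "head G e = v" using all by blast
      thus "p \<in> (\<lambda>e. (tail G e, head G e)) ` S" using p cut[of e] by (force simp: Y_def)
    qed
    hence "card (X \<times> Y) \<le> card S" using fin by (meson surj_card_le)
    hence "card X * card Y \<le> k" using S by (simp add: card_cartesian_product)
    moreover obtain x y where "card X = Suc x" "card Y = Suc y"
      using fin X Y by (metis card_eq_0_iff not0_implies_Suc)
    ultimately show False using xy k n by simp
  qed
  then obtain u v where uv: "u \<in> X" "v \<in> Y" "\<not> u \<rightarrow>\<^bsub>G\<^esub> v" by blast
  \<comment> \<open>\<open>g e\<close> is an end of \<open>e\<close>, and for a crossing arc it is neither \<open>u\<close> nor \<open>v\<close>.\<close>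
  define g where "g e = (if tail G e \<noteq> u then tail G e else head G e)" for e
  define crossing where "crossing = {e \<in> arcs G. tail G e \<in> X \<and> head G e \<in> Y}"
  have crossing: "crossing \<subseteq> S" using cut by (auto simp: crossing_def Y_def)
  have gV: "g ` crossing \<subseteq> verts G - {u, v}"
  proof (intro image_subsetI)
    fix e assume e: "e \<in> crossing"
    have "tail G e \<rightarrow>\<^bsub>G\<^esub> head G e" using e by (auto simp: crossing_def arcs_ends_conv)
    hence "\<not> (tail G e = u \<and> head G e = v)" using uv(3) by metis
    thus "g e \<in> verts G - {u, v}"
      using e uv(1,2) Y(3) by (auto simp: g_def crossing_def)
  qed
  have "card (g ` crossing) \<le> k"
    using card_image_le[of crossing g] card_mono[OF fin(1) crossing] S
      finite_subset[OF crossing fin(1)] by simp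
  moreover have "card (verts G - {u, v}) = card (verts G) - 2"
  proof -
    have "u \<noteq> v" "{u, v} \<subseteq> verts G" using uv X Y by auto
    thus ?thesis by (simp add: card_Diff_subset)
  qed
  ultimately obtain A where A: "g ` crossing \<subseteq> A" "A \<subseteq> verts G - {u, v}" "card A = k"
    using exists_subset_between[of "g ` crossing" k "verts G - {u,v}"] gV k by auto
  show ?thesis
  proof (rule that[of "X - A" "Y - A"])
    show "u' \<in> X - A \<Longrightarrow> v' \<in> Y - A \<Longrightarrow> (u', v') \<notin> arcs_ends G" for u' v'
    proof
      assume u': "u' \<in> X - A" and v': "v' \<in> Y - A" and "u' \<rightarrow>\<^bsub>G\<^esub> v'"
      then obtain e where e: "e \<in> arcs G" "tail G e = u'" "head G e = v'" by blast
      hence "g e \<in> A" using u' v' A(1) by (auto simp: crossing_def)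
      thus False using e u' v' by (auto simp: g_def split: if_splits)
    qed
    have "verts G - ((X - A) \<union> (Y - A)) = A" using X A(2) by (auto simp: Y_def)
    thus "card (verts G - ((X - A) \<union> (Y - A))) = k" using A(3) by simp
  qed (use uv X Y A(2) in auto)
qed

section \<open>The minimal spectral radius\<close>

lemma block_eigenvalue_ge_block_eigenvalue_1:
  assumes "0 \<le> \<alpha>" "\<alpha> < 1" "1 \<le> c" "c \<le> N - 1"
  shows "block_eigenvalue \<alpha> n (N - 1) 1 \<le> block_eigenvalue \<alpha> n (N - c) c"
    and "block_eigenvalue \<alpha> n (N - c) c = block_eigenvalue \<alpha> n (N - 1) 1 \<Longrightarrow>
      c = 1 \<or> \<alpha> = 0 \<and> c = N - 1"
  using block_root_ge_block_root_1[OF assms, of n] by (auto simp: block_eigenvalue_def)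

lemma D_alpha_spectral_radius_of_digraph_iso_K_nkm:
  fixes G :: "('a,'b) pre_digraph"
  assumes G: "digraph G" and iso: "digraph_iso G (K_nkm n k m)"
    and k: "1 \<le> k" and m: "1 \<le> m" "m \<le> n - k - 1" and \<alpha>: "0 \<le> \<alpha>" "\<alpha> < 1"
  shows "D_alpha_spectral_radius \<alpha> G = D_alpha_spectral_radius \<alpha> (K_nkm n k m)"
proof -
  interpret digraph G by (rule G)
  obtain B C where blk: "complete_minus_block G B C" and card: "card (verts G) = n"
    "card B = n - k - m" "card C = m"
    using complete_minus_block_of_digraph_iso_K_nkm[OF wf_digraph iso m] by blast
  have "B \<noteq> {}" "C \<noteq> {}" using card m by auto
  moreover have "verts G - (B \<union> C) \<noteq> {}"
  proof
    assume "verts G - (B \<union> C) = {}"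
    hence "card (verts G) \<le> card (B \<union> C)"
      using blk by (intro card_mono) (auto simp: complete_minus_block_def intro: finite_subset)
    also have "\<dots> \<le> card B + card C" by (rule card_Un_le)
    finally show False using card k m by simp
  qed
  ultimately have "D_alpha_spectral_radius \<alpha> G = block_eigenvalue \<alpha> n (n - k - m) m"
    using D_alpha_spectral_radius_complete_minus_block[OF blk] card \<alpha> by simp
  thus ?thesis using D_alpha_spectral_radius_K_nkm k m \<alpha> by simp
qed

text \<open>
  The missing block found in \<open>G\<close> has some size \<open>b\<close> times \<open>c\<close> with \<open>b + c = n - k\<close>. Passing to the
  complete digraph without this block and then to \<open>c = 1\<close> does not increase the spectral radius, and
  equality forces both steps to be trivial, except that \<open>c = n - k - 1\<close> is as good as \<open>c = 1\<close> for
  \<open>\<alpha> = 0\<close>.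
\<close>

lemma D_alpha_spectral_radius_ge_K_nkm:
  fixes G :: "('a,'b) pre_digraph"
  assumes k: "1 \<le> k" "k \<le> n - 2" and G: "G \<in> digraphs_arc_connectivity n k"
    and \<alpha>: "0 \<le> \<alpha>" "\<alpha> < 1"
  shows "D_alpha_spectral_radius \<alpha> (K_nkm n k 1) \<le> D_alpha_spectral_radius \<alpha> G"
    and "D_alpha_spectral_radius \<alpha> G = D_alpha_spectral_radius \<alpha> (K_nkm n k 1) \<Longrightarrow>
      digraph_iso G (K_nkm n k 1) \<or> \<alpha> = 0 \<and> digraph_iso G (K_nkm n k (n - k - 1))"
proof -
  have dig: "digraph G" and sc: "strongly_connected G" and n: "card (verts G) = n"
    and con: "arc_connectivity G = k"
    using G by (simp_all add: digraphs_arc_connectivity_def)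
  interpret digraph G by (rule dig)
  have n3: "3 \<le> n" using k by simp
  have k': "k \<le> card (verts G) - 2" "2 \<le> card (verts G)" using k n n3 by auto
  obtain B C where sub: "B \<subseteq> verts G" "C \<subseteq> verts G" "B \<inter> C = {}" and ne: "B \<noteq> {}" "C \<noteq> {}"
    and A: "card (verts G - (B \<union> C)) = k"
    and no_arc: "\<And>u v. u \<in> B \<Longrightarrow> v \<in> C \<Longrightarrow> \<not> u \<rightarrow>\<^bsub>G\<^esub> v"
    using ex_missing_block[OF dig k' con] by blast
  have fin: "finite B" "finite C" using sub by (auto intro: finite_subset)
  have "card (B \<union> C) = card B + card C" using fin sub by (simp add: card_Un_disjoint)
  moreover have "k + card (B \<union> C) = n"
    using sub n card_Diff_subset[of "B \<union> C" "verts G"] fin A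
      card_mono[of "verts G" "B \<union> C"] by simp
  ultimately have cards: "k + card B + card C = n" by simp
  have pos: "1 \<le> card B" "1 \<le> card C" using ne fin by (auto simp: Suc_le_eq card_gt_0_iff)
  define N where "N = real (n - k)"
  have bN: "real (card B) = N - real (card C)" using cards by (simp add: N_def)
  have cN: "1 \<le> real (card C)" "real (card C) \<le> N - 1" using cards pos by (auto simp: N_def)
  have K1: "D_alpha_spectral_radius \<alpha> (K_nkm n k 1) = block_eigenvalue \<alpha> n (N - 1) 1"
  proof -
    have "n - k = n - k - 1 + 1" using cards pos by simp
    hence "N = real (n - k - 1 + 1)" unfolding N_def by (rule arg_cong)
    hence "real (n - k - 1) = N - 1" by (simp only: of_nat_add of_nat_1 add_diff_cancel_right')
    moreover have "D_alpha_spectral_radius \<alpha> (K_nkm n k 1) =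
        block_eigenvalue \<alpha> (real n) (real (n - k - 1)) (real 1)"
      by (rule D_alpha_spectral_radius_K_nkm) (use cards pos k \<alpha> in auto)
    ultimately show ?thesis by (simp only: of_nat_1)
  qed
  have ge: "block_eigenvalue \<alpha> n (N - 1) 1 \<le> block_eigenvalue \<alpha> n (card B) (card C)"
    unfolding bN by (rule block_eigenvalue_ge_block_eigenvalue_1(1)[OF \<alpha> cN])
  have hub: "verts G - (B \<union> C) \<noteq> {}" using A k by (metis card.empty not_one_le_zero)
  have eq: "D_alpha_spectral_radius \<alpha> G = block_eigenvalue \<alpha> n (card B) (card C)"
    if "complete_minus_block G B C"
    using D_alpha_spectral_radius_complete_minus_block[OF that hub ne \<alpha>] n by simp
  have gt: "block_eigenvalue \<alpha> n (card B) (card C) < D_alpha_spectral_radius \<alpha> G"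
    if "\<not> complete_minus_block G B C"
    using D_alpha_spectral_radius_gt_block_eigenvalue[OF sc _ sub ne \<alpha> no_arc that] n n3 by simp
  show "D_alpha_spectral_radius \<alpha> (K_nkm n k 1) \<le> D_alpha_spectral_radius \<alpha> G"
    using eq gt ge K1 by linarith
  assume min: "D_alpha_spectral_radius \<alpha> G = D_alpha_spectral_radius \<alpha> (K_nkm n k 1)"
  have blk: "complete_minus_block G B C" using min gt ge K1 by fastforce
  hence "block_eigenvalue \<alpha> n (N - card C) (card C) = block_eigenvalue \<alpha> n (N - 1) 1"
    using min eq K1 bN by simp
  hence "real (card C) = 1 \<or> \<alpha> = 0 \<and> real (card C) = N - 1"
    using block_eigenvalue_ge_block_eigenvalue_1(2)[OF \<alpha> cN] by blast
  hence "card C = 1 \<or> \<alpha> = 0 \<and> card C = n - k - 1"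
    using cards pos by (auto simp: N_def)
  thus "digraph_iso G (K_nkm n k 1) \<or> \<alpha> = 0 \<and> digraph_iso G (K_nkm n k (n - k - 1))"
    using digraph_iso_K_nkm_of_complete_minus_block[OF dig blk n A refl ne] by auto
qed

theorem theorem5p4:
  fixes G :: "('a,'b) pre_digraph" and n k :: nat
  assumes "1 \<le> k" and "k \<le> n - 2"
    and "G \<in> digraphs_arc_connectivity n k"
  shows "(D_alpha_spectral_radius 0 G \<ge> D_alpha_spectral_radius 0 (K_nkm n k 1)
      \<and> D_alpha_spectral_radius 0 (K_nkm n k 1) = D_alpha_spectral_radius 0 (K_nkm n k (n - k - 1))
      \<and> (D_alpha_spectral_radius 0 G = D_alpha_spectral_radius 0 (K_nkm n k 1)
          \<longleftrightarrow> digraph_iso G (K_nkm n k (n - k - 1)) \<or> digraph_iso G (K_nkm n k 1)))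
    \<and> (\<forall>\<alpha>::real. 0 < \<alpha> \<and> \<alpha> < 1 \<longrightarrow>
        D_alpha_spectral_radius \<alpha> G \<ge> D_alpha_spectral_radius \<alpha> (K_nkm n k 1)
      \<and> (D_alpha_spectral_radius \<alpha> G = D_alpha_spectral_radius \<alpha> (K_nkm n k 1)
          \<longleftrightarrow> digraph_iso G (K_nkm n k 1)))"
proof -
  have dig: "digraph G" using assms(3) by (simp add: digraphs_arc_connectivity_def)
  have m: "1 \<le> n - k - 1" "n - k - 1 \<le> n - k - 1" using assms(1,2) by auto
  have swap: "D_alpha_spectral_radius 0 (K_nkm n k 1) = D_alpha_spectral_radius 0 (K_nkm n k (n - k - 1))"
    using assms(1) m
    by (simp add: D_alpha_spectral_radius_K_nkm block_eigenvalue_def block_root_0_swap)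
  have iso_1: "D_alpha_spectral_radius \<alpha> G = D_alpha_spectral_radius \<alpha> (K_nkm n k 1)"
    if "digraph_iso G (K_nkm n k 1)" "0 \<le> \<alpha>" "\<alpha> < 1" for \<alpha>
    using D_alpha_spectral_radius_of_digraph_iso_K_nkm[OF dig that(1) assms(1) _ m(1)] that by simp
  have iso_2: "D_alpha_spectral_radius 0 G = D_alpha_spectral_radius 0 (K_nkm n k (n - k - 1))"
    if "digraph_iso G (K_nkm n k (n - k - 1))"
    using D_alpha_spectral_radius_of_digraph_iso_K_nkm[OF dig that assms(1) m] by simp
  note min = D_alpha_spectral_radius_ge_K_nkm[OF assms]
  show ?thesis
  proof (intro conjI allI impI)
    show "D_alpha_spectral_radius 0 G = D_alpha_spectral_radius 0 (K_nkm n k 1)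
        \<longleftrightarrow> digraph_iso G (K_nkm n k (n - k - 1)) \<or> digraph_iso G (K_nkm n k 1)"
      using min(2)[of 0] iso_1[of 0] iso_2 swap by auto
    show "D_alpha_spectral_radius \<alpha> G = D_alpha_spectral_radius \<alpha> (K_nkm n k 1)
        \<longleftrightarrow> digraph_iso G (K_nkm n k 1)" if "0 < \<alpha> \<and> \<alpha> < 1" for \<alpha>
      using min(2)[of \<alpha>] iso_1[of \<alpha>] that by auto
    show "D_alpha_spectral_radius 0 (K_nkm n k 1) \<le> D_alpha_spectral_radius 0 G"
      by (rule min(1)) auto
    show "D_alpha_spectral_radius \<alpha> (K_nkm n k 1) \<le> D_alpha_spectral_radius \<alpha> G"
      if "0 < \<alpha> \<and> \<alpha> < 1" for \<alpha>
      using that by (intro min(1)) auto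
  qed (rule swap)
qed

end
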